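(* Let $m,p\in\mathbb{N}_0$ and let the real parameters $A=((a_i,\alpha_i))_{1\le i\le p}$, $B=((b_j,\beta_j))_{1\le j\le m}$ satisfy the parameter assumptions (1)-(4) of the context. Let $\mathbb{H}\in(0,1)$ and let $X^{\mathbb{H},A,B}$ be the generalized Fox-$H$ process on $(\mathcal{S}',\mathcal{C}_\sigma(\mathcal{S}'),\mu_\Psi)$. If $2b_j+\beta_j>0$ for $j=1,\dots,m$, then for every Borel set $I\subset[0,1]$ the process $X^{\mathbb{H},A,B}$ admits, $\mu_\Psi$-almost surely, a local time $L^{X^{\mathbb{H},A,B}}(\cdot,I)$ that is square integrable with respect to Lebesgue measure $\lambda$ on $\mathbb{R}$.
   Context: **Parameter assumptions.** $m,p\in\mathbb{N}_0$ and: (1) $a_i\in\mathbb{R}$, $\alpha_i>0$, $a_i+\alpha_i>0$ for $i=1,\dots,p$; (2) $b_j\in\mathbb{R}$, $\beta_j>0$, $b_j+\beta_j>0$ for $j=1,\dots,m$; (3) with $a^*:=\sum_{j=1}^m\beta_j-\sum_{i=1}^p\alpha_i$ and $\mu:=\sum_{j=1}^m b_j-\sum_{i=1}^p a_i+(p-m)/2$, either $a^*>0$, or $a^*=0$ and $\mu<-1$; (4) the Fox-$H$ function $$H^{m,0}_{p,m}(\tau):=\frac{1}{2\pi \mathrm{i}}\int_{\gamma-\mathrm{i}\infty}^{\gamma+\mathrm{i}\infty}\frac{\prod_{j=1}^m\Gamma(b_j+\beta_js)}{\prod_{i=1}^p\Gamma(a_i+\alpha_is)}\,\tau^{-s}\,\mathrm{d}s,\quad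 \tau>0,$$ (with $\gamma>\max_j(-b_j/\beta_j)$, e.g. $\gamma=1$) is non-negative on $(0,\infty)$. Empty sums are $0$, empty products are $1$. Put $K=\prod_{j=1}^m\Gamma(b_j+\beta_j)/\prod_{i=1}^p\Gamma(a_i+\alpha_i)$. Known fact: under these assumptions $\varrho_H:=\frac1K H^{m,0}_{p,m}$ is a probability density on $(0,\infty)$ with finite moments of all orders and Laplace transform $s\mapsto\frac1K\,{}_m\Psi_p(-s)$, $s\ge0$. **Generalized Wright function.** ${}_m\Psi_p(z):=\sum_{k\ge0}\frac{\prod_{j=1}^m\Gamma(b_j+\beta_j+\beta_jk)}{\prod_{i=1}^p\Gamma(a_i+\alpha_i+\alpha_ik)}\frac{z^k}{k!}$ (entire if $a^*<1$). For $s>0$, in general, ${}_m\Psi_p(-s)$ is understood through its Fox-$H$ representation ${}_m\Psi_p(-s)=\frac{1}{2\pi \mathrm{i}}\int_{c-\mathrm{i}\infty}^{c+\mathrm{i}\infty}\Gamma(u)\frac{\prod_j\Gamma(b_j+\beta_j-\beta_ju)}{\prod_i\Gamma(a_i+\alpha_i-\alpha_iu)}s^{-u}\,\mathrm{d}u$ with $0<c<\min_j(b_j+\beta_j)/\beta_j$, and ${}_m\Psi_p(0)=K$. **The measure.** Let $\mathcal{S}=\mathcal{S}(\mathbb{R})$ be the real Schwartz space, $\mathcal{S}'$ its dual with pairing $\langle\cdot,\cdot\rangle$ extending the inner product of $L^2(\mathbb{R},\mathrm{d}x)$, and $\mathcal{C}_\sigma(\mathcal{S}')$ the cylinder $\sigma$-algebra.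 The generalized Fox-$H$ measure $\mu_\Psi$ is the unique probability measure on $(\mathcal{S}',\mathcal{C}_\sigma(\mathcal{S}'))$ with $\int_{\mathcal{S}'}e^{\mathrm{i}\langle\omega,\varphi\rangle}\,\mathrm{d}\mu_\Psi(\omega)=\frac1K\,{}_m\Psi_p\big(-\frac12\langle\varphi,\varphi\rangle\big)$, $\varphi\in\mathcal{S}$. One has $\|\langle\cdot,\varphi\rangle\|_{L^2(\mu_\Psi)}=c\,|\varphi|_{L^2(\mathbb{R})}$ for a constant $c$; hence $\langle\cdot,f\rangle\in L^2(\mu_\Psi)$ is defined for $f\in L^2(\mathbb{R})$ by $L^2(\mu_\Psi)$-limits. **Fractional operator.** $M_-^{\mathbb{H}}f=K_{\mathbb{H}}D_-^{1/2-\mathbb{H}}f$ if $\mathbb{H}<1/2$, $M_-^{1/2}f=f$, $M_-^{\mathbb{H}}f=K_{\mathbb{H}}I_-^{\mathbb{H}-1/2}f$ if $\mathbb{H}>1/2$, where for $\sigma\in(0,1)$ $(I_-^\sigma f)(x)=\frac{1}{\Gamma(\sigma)}\int_x^\infty f(t)(t-x)^{\sigma-1}\mathrm{d}t$, $(D_-^\sigma f)(x)=-\frac{1}{\Gamma(1-\sigma)}\frac{\mathrm{d}}{\mathrm{d}x}\int_x^\infty f(t)(t-x)^{-\sigma}\mathrm{d}t$, and $K_{\mathbb{H}}=\Gamma(\mathbb{H}+\tfrac12)\big(\int_0^\infty((1+s)^{\mathbb{H}-1/2}-s^{\mathbb{H}-1/2})^2\mathrm{d}s+\frac{1}{2\mathbb{H}}\big)^{-1/2}$.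 Known: $M_-^{\mathbb{H}}\mathbf{1}_{[0,t)}\in L^2(\mathbb{R})$ and $(M_-^{\mathbb{H}}\mathbf{1}_{[0,t)},M_-^{\mathbb{H}}\mathbf{1}_{[0,s)})_{L^2}=\frac12(t^{2\mathbb{H}}+s^{2\mathbb{H}}-|t-s|^{2\mathbb{H}})$. **Generalized Fox-$H$ process.** $X_t^{\mathbb{H},A,B}:=\langle\cdot,M_-^{\mathbb{H}}\mathbf{1}_{[0,t)}\rangle$, $t\ge0$; it has a version with continuous paths, which is used here. **Local time.** For a Borel set $I\subset[0,1]$ and measurable $f:I\to\mathbb{R}$ the occupation measure is $\mu_f(C)=\int_I\mathbf{1}_C(f(s))\,\mathrm{d}s$, $C\in\mathcal{B}(\mathbb{R})$. If $\mu_f\ll\lambda$, its density $L^f(\cdot,I)=\mathrm{d}\mu_f/\mathrm{d}\lambda$ is called the occupation density of $f$ over $I$. A continuous process has local time (occupation density) on $I$ if almost every path has an occupation density over $I$. *)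

theory Defs
  imports "HOL-Probability.Probability"
begin

text \<open>
  The parameter tuples \<open>A = ((a\<^sub>i, \<alpha>\<^sub>i))\<close>, \<open>1 \<le> i \<le> p\<close>, and \<open>B = ((b\<^sub>j, \<beta>\<^sub>j))\<close>, \<open>1 \<le> j \<le> m\<close>,
  are functions on \<open>nat\<close>; only the values at \<open>1..p\<close> and \<open>1..m\<close> matter.
\<close>

definition fox_a_star :: "nat \<Rightarrow> nat \<Rightarrow> (nat \<Rightarrow> real) \<Rightarrow> (nat \<Rightarrow> real) \<Rightarrow> real" where
  "fox_a_star m p \<alpha> \<beta> = (\<Sum>j=1..m. \<beta> j) - (\<Sum>i=1..p. \<alpha> i)"

definition fox_mu :: "nat \<Rightarrow> nat \<Rightarrow> (nat \<Rightarrow> real) \<Rightarrow> (nat \<Rightarrow> real) \<Rightarrow> real" where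
  "fox_mu m p a b = (\<Sum>j=1..m. b j) - (\<Sum>i=1..p. a i) + (real p - real m) / 2"

definition fox_K ::
  "nat \<Rightarrow> nat \<Rightarrow> (nat \<Rightarrow> real) \<Rightarrow> (nat \<Rightarrow> real) \<Rightarrow> (nat \<Rightarrow> real) \<Rightarrow> (nat \<Rightarrow> real) \<Rightarrow> real" where
  "fox_K m p a \<alpha> b \<beta> = (\<Prod>j=1..m. Gamma (b j + \<beta> j)) / (\<Prod>i=1..p. Gamma (a i + \<alpha> i))"

text \<open>
  The integral of \<open>f\<close> over the line from \<open>c - \<i>\<infinity>\<close> to \<open>c + \<i>\<infinity>\<close>, divided by \<open>2\<pi>\<i>\<close>; along
  \<open>u = c + \<i>y\<close> one has \<open>du = \<i> dy\<close>. All integrals below converge absolutely under the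
  assumptions of the theorem, so that the Lebesgue integral over \<open>y\<close> is appropriate.
\<close>

definition vertical_integral :: "real \<Rightarrow> (complex \<Rightarrow> complex) \<Rightarrow> complex" where
  "vertical_integral c f = 1 / (2 * of_real pi * \<i>) * (LINT y|lborel. f (Complex c y) * \<i>)"

text \<open>
  Since \<open>Gamma z = 0\<close> at the poles \<open>z\<close> and \<open>x / 0 = 0\<close>, the factors \<open>1 / Gamma z\<close> have their
  usual value \<open>0\<close> there.
\<close>

definition fox_H ::
  "real \<Rightarrow> nat \<Rightarrow> nat \<Rightarrow> (nat \<Rightarrow> real) \<Rightarrow> (nat \<Rightarrow> real) \<Rightarrow> (nat \<Rightarrow> real) \<Rightarrow> (nat \<Rightarrow> real) \<Rightarrow>
    real \<Rightarrow> complex" where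
  "fox_H \<gamma> m p a \<alpha> b \<beta> \<tau> =
     vertical_integral \<gamma> (\<lambda>s.
       (\<Prod>j=1..m. Gamma (of_real (b j) + of_real (\<beta> j) * s))
       / (\<Prod>i=1..p. Gamma (of_real (a i) + of_real (\<alpha> i) * s))
       * of_real \<tau> powr (- s))"

text \<open>
  \<open>wright_neg c m p a \<alpha> b \<beta> s\<close> is the value of the generalized Wright function at \<open>-s\<close> for
  \<open>s \<ge> 0\<close>. The power series need not converge for \<open>s > 0\<close> (it is entire if
  \<open>fox_a_star m p \<alpha> \<beta> < 1\<close>), so the function is given by its Fox-\<open>H\<close> representation there, with
  the abscissa \<open>c\<close> of the line of integration subject to \<open>0 < c\<close> and \<open>c < (b\<^sub>j + \<beta>\<^sub>j) / \<beta>\<^sub>j\<close> for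
  all \<open>j\<close>.
\<close>

definition wright_neg ::
  "real \<Rightarrow> nat \<Rightarrow> nat \<Rightarrow> (nat \<Rightarrow> real) \<Rightarrow> (nat \<Rightarrow> real) \<Rightarrow> (nat \<Rightarrow> real) \<Rightarrow> (nat \<Rightarrow> real) \<Rightarrow>
    real \<Rightarrow> complex" where
  "wright_neg c m p a \<alpha> b \<beta> s =
     (if s = 0 then of_real (fox_K m p a \<alpha> b \<beta>)
      else vertical_integral c (\<lambda>u.
        Gamma u
        * ((\<Prod>j=1..m. Gamma (of_real (b j + \<beta> j) - of_real (\<beta> j) * u))
           / (\<Prod>i=1..p. Gamma (of_real (a i + \<alpha> i) - of_real (\<alpha> i) * u)))
        * of_real s powr (- u)))"

definition schwartz :: "(real \<Rightarrow> real) set" where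
  "schwartz = {\<phi>.
     (\<forall>n x. (deriv ^^ n) \<phi> differentiable (at x)) \<and>
     (\<forall>k n. bdd_above (range (\<lambda>x. \<bar>x ^ k * (deriv ^^ n) \<phi> x\<bar>)))}"

definition schwartz_seminorm :: "nat \<Rightarrow> nat \<Rightarrow> (real \<Rightarrow> real) \<Rightarrow> real" where
  "schwartz_seminorm k n \<phi> = (SUP x. \<bar>x ^ k * (deriv ^^ n) \<phi> x\<bar>)"

definition schwartz_topology :: "(real \<Rightarrow> real) topology" where
  "schwartz_topology = topology_generated_by
     {{\<psi> \<in> schwartz. schwartz_seminorm k n (\<lambda>x. \<psi> x - \<phi> x) < e} | k n \<phi> e.
        \<phi> \<in> schwartz \<and> 0 < e}"

text \<open>
  A tempered distribution is represented by a function on all of \<open>real \<Rightarrow> real\<close> that is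
  \<open>undefined\<close> outside of \<open>schwartz\<close>, and the dual pairing of \<open>\<omega>\<close> and \<open>\<phi>\<close> is \<open>\<omega> \<phi>\<close>.
\<close>

definition tempered :: "((real \<Rightarrow> real) \<Rightarrow> real) set" where
  "tempered = {\<omega> \<in> extensional schwartz.
     (\<forall>\<phi>\<in>schwartz. \<forall>\<psi>\<in>schwartz. \<omega> (\<lambda>x. \<phi> x + \<psi> x) = \<omega> \<phi> + \<omega> \<psi>) \<and>
     (\<forall>r. \<forall>\<phi>\<in>schwartz. \<omega> (\<lambda>x. r * \<phi> x) = r * \<omega> \<phi>) \<and>
     continuous_map schwartz_topology euclideanreal \<omega>}"

definition cylinder_algebra :: "((real \<Rightarrow> real) \<Rightarrow> real) measure" where
  "cylinder_algebra = sigma tempered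
     {{\<omega> \<in> tempered. \<omega> \<phi> \<in> C} | \<phi> C. \<phi> \<in> schwartz \<and> C \<in> sets borel}"

definition fox_H_measure ::
  "real \<Rightarrow> nat \<Rightarrow> nat \<Rightarrow> (nat \<Rightarrow> real) \<Rightarrow> (nat \<Rightarrow> real) \<Rightarrow> (nat \<Rightarrow> real) \<Rightarrow> (nat \<Rightarrow> real) \<Rightarrow>
    ((real \<Rightarrow> real) \<Rightarrow> real) measure \<Rightarrow> bool" where
  "fox_H_measure c m p a \<alpha> b \<beta> M \<longleftrightarrow>
     prob_space M \<and> sets M = sets cylinder_algebra \<and>
     (\<forall>\<phi>\<in>schwartz.
        (LINT \<omega>|M. iexp (\<omega> \<phi>)) =
        1 / of_real (fox_K m p a \<alpha> b \<beta>)
          * wright_neg c m p a \<alpha> b \<beta> (1 / 2 * (LINT x|lborel. \<phi> x * \<phi> x)))"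

text \<open>
  \<open>L2_pairing M f Y\<close>: the random variable \<open>Y\<close> is a representative of the element \<open>\<langle>\<cdot>, f\<rangle>\<close> of
  \<open>L\<^sup>2(M)\<close>, the \<open>L\<^sup>2(M)\<close>-limit of \<open>\<langle>\<cdot>, \<phi>\<^sub>n\<rangle>\<close> for Schwartz functions \<open>\<phi>\<^sub>n\<close> tending to \<open>f\<close> in
  \<open>L\<^sup>2(\<real>)\<close>.
\<close>

definition L2_pairing ::
  "((real \<Rightarrow> real) \<Rightarrow> real) measure \<Rightarrow> (real \<Rightarrow> real) \<Rightarrow> (((real \<Rightarrow> real) \<Rightarrow> real) \<Rightarrow> real) \<Rightarrow> bool"
  where
  "L2_pairing M f Y \<longleftrightarrow>
     Y \<in> borel_measurable M \<and>
     (\<exists>\<phi> :: nat \<Rightarrow> real \<Rightarrow> real.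
        (\<forall>n. \<phi> n \<in> schwartz) \<and>
        (\<lambda>n. \<integral>\<^sup>+ x. ennreal ((\<phi> n x - f x)\<^sup>2) \<partial>lborel) \<longlonglongrightarrow> 0 \<and>
        (\<lambda>n. \<integral>\<^sup>+ \<omega>. ennreal ((\<omega> (\<phi> n) - Y \<omega>)\<^sup>2) \<partial>M) \<longlonglongrightarrow> 0)"

definition frac_integral_minus :: "real \<Rightarrow> (real \<Rightarrow> real) \<Rightarrow> real \<Rightarrow> real" where
  "frac_integral_minus \<sigma> f x =
     1 / Gamma \<sigma> * (LINT t:{x<..}|lborel. f t * (t - x) powr (\<sigma> - 1))"

definition frac_deriv_minus :: "real \<Rightarrow> (real \<Rightarrow> real) \<Rightarrow> real \<Rightarrow> real" where
  "frac_deriv_minus \<sigma> f x =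
     - 1 / Gamma (1 - \<sigma>) * deriv (\<lambda>y. LINT t:{y<..}|lborel. f t * (t - y) powr (- \<sigma>)) x"

definition hurst_const :: "real \<Rightarrow> real" where
  "hurst_const H =
     Gamma (H + 1 / 2)
     * ((LINT s:{0<..}|lborel. ((1 + s) powr (H - 1 / 2) - s powr (H - 1 / 2))\<^sup>2)
        + 1 / (2 * H)) powr (- 1 / 2)"

definition M_minus :: "real \<Rightarrow> (real \<Rightarrow> real) \<Rightarrow> real \<Rightarrow> real" where
  "M_minus H f =
     (if H < 1 / 2 then (\<lambda>x. hurst_const H * frac_deriv_minus (1 / 2 - H) f x)
      else if H = 1 / 2 then f
      else (\<lambda>x. hurst_const H * frac_integral_minus (H - 1 / 2) f x))"

text \<open>
  \<open>X\<close> is a version with continuous paths of the process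
  \<open>\<langle>\<cdot>, M_minus H (indicator {0..<t})\<rangle>\<close>, \<open>t \<ge> 0\<close>; values of \<open>X t\<close> for negative \<open>t\<close> are irrelevant.
\<close>

definition fox_H_process ::
  "((real \<Rightarrow> real) \<Rightarrow> real) measure \<Rightarrow> real \<Rightarrow> (real \<Rightarrow> ((real \<Rightarrow> real) \<Rightarrow> real) \<Rightarrow> real) \<Rightarrow> bool"
  where
  "fox_H_process M H X \<longleftrightarrow>
     (\<forall>t\<ge>0. L2_pairing M (M_minus H (indicator {0..<t})) (X t)) \<and>
     (\<forall>\<omega>\<in>space M. continuous_on {0..} (\<lambda>t. X t \<omega>))"

definition occupation_measure :: "(real \<Rightarrow> real) \<Rightarrow> real set \<Rightarrow> real measure" where
  "occupation_measure f I = distr (restrict_space lborel I) borel f"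

definition has_occupation_density :: "(real \<Rightarrow> real) \<Rightarrow> real set \<Rightarrow> bool" where
  "has_occupation_density f I \<longleftrightarrow> absolutely_continuous lborel (occupation_measure f I)"

definition occupation_density :: "(real \<Rightarrow> real) \<Rightarrow> real set \<Rightarrow> real \<Rightarrow> ennreal" where
  "occupation_density f I = RN_deriv lborel (occupation_measure f I)"

end

theory Submission
  imports Defs "HOL-Complex_Analysis.Complex_Analysis" "HOL-Real_Asymp.Real_Asymp"
begin

text \<open>
  A finite measure \<open>\<mu>\<close> on the line has a square integrable density as soon as its Gaussian energies
  \<open>\<integral>\<integral> k\<^sub>\<epsilon>(x - y) d\<mu>(x) d\<mu>(y)\<close> stay bounded along some sequence \<open>\<epsilon> \<rightarrow> 0\<close>. For the occupation
  measure of \<open>X\<close> the expected energy is the integral of \<open>E k\<^sub>\<epsilon>(X\<^sub>t - X\<^sub>s)\<close> over \<open>I \<times> I\<close>; by Fourier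
  inversion of the Gaussian it is at most the integral of the modulus of the characteristic function
  of \<open>X\<^sub>t - X\<^sub>s\<close>. By Fatou's lemma it is therefore enough that this integral is \<open>O(\<bar>t - s\<bar> powr (- H))\<close>.

  The characteristic function is the Wright function at \<open>- \<xi>\<^sup>2 \<parallel>g\<parallel>\<^sup>2 / 2\<close>, where \<open>g\<close> is the increment of
  the fractional kernels and \<open>\<parallel>g\<parallel>\<^sup>2 \<ge> const * \<bar>t - s\<bar> powr (2 H)\<close>. The hypothesis \<open>2 b\<^sub>j + \<beta>\<^sub>j > 0\<close>
  says that all poles \<open>(b\<^sub>j + \<beta>\<^sub>j) / \<beta>\<^sub>j\<close> lie to the right of \<open>1/2\<close>, so the line of integration in the
  Mellin--Barnes representation can be moved to an abscissa \<open>q > 1/2\<close>. This gives the decay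
  \<open>O(s powr (- q))\<close> at \<open>- s\<close>, which is integrable in \<open>\<xi>\<close>.
\<close>

section \<open>Gamma functions on vertical lines\<close>

text \<open>The threshold \<open>1/2\<close> comes from the square in the characteristic functional:
  its argument is quadratic in \<xi>, so decay of order q there is decay of order 2q in \<xi>,
  integrable at infinity exactly for \<open>q > 1/2\<close>; near 0 the bound 1 for characteristic
  functions takes over. Rescaling \<xi> by \<open>(t - s) powr H\<close> then produces the factor
  \<open>\<bar>t - s\<bar> powr (- H)\<close>, integrable because \<open>H < 1\<close>. In the
  Mellin--Barnes integrand the poles of \<open>Gamma u\<close> lie at \<open>Re u \<le> 0\<close>
  and the others to the right of q, so moving the line picks up no residue. \<open>Gamma u\<close>
  alone supplies decay of rate pi/2 along vertical lines, and a nonnegative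
  \<open>fox_a_star\<close> says that the remaining factors together add no exponential growth; this
  treats the cases \<open>> 0\<close> and \<open>= 0\<close> alike. Gaussian kernels are chosen
  because they are positive, so that integrals over pairs of times and over sample points are
  exchanged by Tonelli, and because they form a convolution semigroup, so that the energy is a
  squared L2 norm of the smoothed measure. Fatou's lemma yields only a finite lower limit of the
  energies: the scales along which they stay bounded depend on the path.\<close>

text \<open>By Euler's product formula the quotient is the product of
  \<open>(x + i) / sqrt ((x + i)\<^sup>2 + y\<^sup>2)\<close>, each factor of which increases with \<open>x\<close>. This replaces
  Stirling's formula: it reduces every growth estimate to the line \<open>Re z = 1/2\<close>, where the
  reflection formula gives the modulus of \<open>Gamma\<close> exactly.\<close>

lemma norm_Gamma_ratio_mono:
  fixes x x' y :: real
  assumes "0 < x" "x \<le> x'"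
  shows "cmod (Gamma (Complex x y)) / Gamma x \<le> cmod (Gamma (Complex x' y)) / Gamma x'"
proof -
  define R where "R u n = cmod (Gamma_series (Complex u y) n) / Gamma_series u n" for u n
  have R_lim: "R u \<longlonglongrightarrow> cmod (Gamma (Complex u y)) / Gamma u" if "u > 0" for u
    unfolding R_def using Gamma_real_pos[OF that]
    by (intro tendsto_intros) auto
  have R_eq: "R u n = (\<Prod>i=0..<Suc n. (u + real i) / sqrt ((u + real i)\<^sup>2 + y\<^sup>2))" if "u > 0" for u n
  proof -
    have "cmod (pochhammer (Complex u y) (n+1)) = (\<Prod>i=0..<Suc n. sqrt ((u + real i)\<^sup>2 + y\<^sup>2))"
      unfolding pochhammer_prod prod_norm[symmetric]
      by (intro prod.cong) (auto simp: cmod_def)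
    moreover have "pochhammer u (n+1) = (\<Prod>i=0..<Suc n. u + real i)"
      by (simp add: pochhammer_prod)
    moreover have "cmod (exp (Complex u y * of_real (ln (of_nat n)))) = exp (u * ln (of_nat n))"
      by simp
    ultimately show ?thesis
      unfolding R_def Gamma_series_def prod_dividef
      by (simp add: norm_mult norm_divide norm_fact del: prod.op_ivl_Suc)
  qed
  have "R x n \<le> R x' n" for n
    unfolding R_eq[OF assms(1)] R_eq[OF less_le_trans[OF assms]]
  proof (intro prod_mono conjI)
    fix i
    have pos: "0 < x + real i" "x + real i \<le> x' + real i" using assms by auto
    have "(x + real i) * sqrt ((x' + real i)\<^sup>2 + y\<^sup>2) = sqrt ((x + real i)\<^sup>2 * ((x' + real i)\<^sup>2 + y\<^sup>2))"
      using pos by (simp add: real_sqrt_mult)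
    also have "\<dots> \<le> sqrt ((x' + real i)\<^sup>2 * ((x + real i)\<^sup>2 + y\<^sup>2))"
    proof -
      have "(x + real i)\<^sup>2 \<le> (x' + real i)\<^sup>2" using pos by (intro power_mono) auto
      then have "(x + real i)\<^sup>2 * y\<^sup>2 \<le> (x' + real i)\<^sup>2 * y\<^sup>2" by (rule mult_right_mono) auto
      then show ?thesis by (simp add: algebra_simps)
    qed
    also have "\<dots> = (x' + real i) * sqrt ((x + real i)\<^sup>2 + y\<^sup>2)"
      using pos by (simp add: real_sqrt_mult)
    finally have "(x + real i) * sqrt ((x' + real i)\<^sup>2 + y\<^sup>2) \<le> (x' + real i) * sqrt ((x + real i)\<^sup>2 + y\<^sup>2)" .
    moreover have "0 < sqrt ((x + real i)\<^sup>2 + y\<^sup>2)" "0 < sqrt ((x' + real i)\<^sup>2 + y\<^sup>2)"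
      using pos by (auto intro!: add_pos_nonneg)
    ultimately show "(x + real i) / sqrt ((x + real i)\<^sup>2 + y\<^sup>2) \<le> (x' + real i) / sqrt ((x' + real i)\<^sup>2 + y\<^sup>2)"
      by (simp add: divide_simps)
  qed (use assms in auto)
  then show ?thesis
    using R_lim[of x] R_lim[of x'] assms by (intro LIMSEQ_le[of "R x" _ "R x'"]) auto
qed

text \<open>On this line \<open>1 - z\<close> is the conjugate of \<open>z\<close>, so the
  reflection formula evaluates \<open>Gamma z * cnj (Gamma z)\<close>.\<close>

lemma norm_Gamma_half: "(cmod (Gamma (Complex (1/2) y)))\<^sup>2 = pi / cosh (pi * y)"
proof -
  let ?z = "Complex (1/2) y"
  have "(cmod (Gamma ?z))\<^sup>2 = cmod (Gamma ?z * cnj (Gamma ?z))"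
    by (simp add: norm_mult power2_eq_square)
  also have "cnj (Gamma ?z) = Gamma (1 - ?z)"
  proof -
    have "cnj ?z = 1 - ?z" by (simp add: complex_eq_iff)
    then show ?thesis by (simp only: cnj_Gamma)
  qed
  also have "Gamma ?z * Gamma (1 - ?z) = of_real pi / sin (of_real pi * ?z)"
    by (rule Gamma_reflection_complex)
  also have "of_real pi * ?z = of_real (pi/2) + \<i> * of_real (pi * y)"
    by (simp add: complex_eq_iff)
  also have "sin \<dots> = cos (\<i> * of_real (pi * y))"
    by (simp only: sin_add cos_of_real sin_of_real) simp
  also have "\<dots> = of_real (cosh (pi * y))"
    by (simp add: cosh_def scaleR_conv_of_real flip: cosh_conv_cos exp_of_real)
  finally show ?thesis by (simp add: norm_divide)
qed

lemma norm_Gamma_half_bounds: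
  "cmod (Gamma (Complex (1/2) y)) \<le> sqrt (2*pi) * exp (- (pi/2) * \<bar>y\<bar>)" (is ?upper)
  "sqrt pi * exp (- (pi/2) * \<bar>y\<bar>) \<le> cmod (Gamma (Complex (1/2) y))" (is ?lower)
proof -
  have *: "cosh (pi * y) = (exp (pi*\<bar>y\<bar>) + exp (-(pi*\<bar>y\<bar>)))/2"
    by (cases "y \<ge> 0") (auto simp: cosh_def)
  have sq: "(exp (- (pi/2) * \<bar>y\<bar>))\<^sup>2 = exp (- (pi*\<bar>y\<bar>))"
    by (simp flip: exp_double)
  have "pi / cosh (pi*y) \<le> (sqrt (2*pi) * exp (- (pi/2) * \<bar>y\<bar>))\<^sup>2"
    unfolding power_mult_distrib sq * by (simp add: divide_simps exp_minus add_pos_pos)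
  then show ?upper
    unfolding norm_Gamma_half[symmetric] by (rule power2_le_imp_le) simp
  have "exp (- (pi*\<bar>y\<bar>)) \<le> exp (pi*\<bar>y\<bar>)" by simp
  then have "(sqrt pi * exp (- (pi/2) * \<bar>y\<bar>))\<^sup>2 \<le> pi / cosh (pi*y)"
    unfolding power_mult_distrib sq * by (simp add: divide_simps exp_minus add_pos_pos)
  then show ?lower
    unfolding norm_Gamma_half[symmetric] by (rule power2_le_imp_le) simp
qed

lemma norm_pochhammer_le: "cmod (pochhammer z n) \<le> (cmod z + real n) ^ n"
proof -
  have "cmod (pochhammer z n) = (\<Prod>i=0..<n. cmod (z + of_nat i))"
    by (simp add: pochhammer_prod prod_norm)
  also have "\<dots> \<le> (\<Prod>i=0..<n. cmod z + real n)"
    by (intro prod_mono conjI order.trans[OF norm_triangle_ineq]) auto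
  finally show ?thesis by simp
qed

lemma integrable_inverse_1_plus_square_lborel: "integrable lborel (\<lambda>x::real. inverse (1 + x\<^sup>2))"
  using integrable_inverse_1_plus_square by (simp add: set_integrable_def)

text \<open>Polynomial factors are absorbed, since only the sum of the rates \<open>r\<close> of all Gamma factors
  matters in the end.\<close>

definition vertical_growth :: "real set \<Rightarrow> real \<Rightarrow> (complex \<Rightarrow> complex) \<Rightarrow> bool" where
  "vertical_growth S r f \<longleftrightarrow>
     (\<exists>C n. C \<ge> 0 \<and> (\<forall>x\<in>S. \<forall>y. cmod (f (Complex x y)) \<le> C * (1 + \<bar>y\<bar>) ^ n * exp (r * \<bar>y\<bar>)))"

lemma vertical_growth_const: "vertical_growth S 0 (\<lambda>z. k)"
  unfolding vertical_growth_def by (rule exI[of _ "cmod k"], rule exI[of _ 0]) auto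

lemma vertical_growth_mult:
  assumes "vertical_growth S r f" "vertical_growth S q g"
  shows "vertical_growth S (r + q) (\<lambda>z. f z * g z)"
proof -
  obtain C n where C: "C \<ge> 0" "\<And>x y. x \<in> S \<Longrightarrow> cmod (f (Complex x y)) \<le> C * (1 + \<bar>y\<bar>) ^ n * exp (r * \<bar>y\<bar>)"
    using assms(1) unfolding vertical_growth_def by blast
  obtain D k where D: "D \<ge> 0" "\<And>x y. x \<in> S \<Longrightarrow> cmod (g (Complex x y)) \<le> D * (1 + \<bar>y\<bar>) ^ k * exp (q * \<bar>y\<bar>)"
    using assms(2) unfolding vertical_growth_def by blast
  show ?thesis unfolding vertical_growth_def
  proof (intro exI conjI ballI allI)
    fix x y assume "x \<in> S"
    then have "cmod (f (Complex x y) * g (Complex x y))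
        \<le> (C * (1 + \<bar>y\<bar>) ^ n * exp (r * \<bar>y\<bar>)) * (D * (1 + \<bar>y\<bar>) ^ k * exp (q * \<bar>y\<bar>))"
      unfolding norm_mult using C D by (intro mult_mono) auto
    then show "cmod (f (Complex x y) * g (Complex x y)) \<le> (C * D) * (1 + \<bar>y\<bar>) ^ (n + k) * exp ((r + q) * \<bar>y\<bar>)"
      by (simp add: power_add algebra_simps exp_add)
  qed (use C D in auto)
qed

lemma vertical_growth_prod:
  assumes "finite I" "\<And>i. i \<in> I \<Longrightarrow> vertical_growth S (r i) (f i)"
  shows "vertical_growth S (\<Sum>i\<in>I. r i) (\<lambda>z. \<Prod>i\<in>I. f i z)"
  using assms by (induction I rule: finite_induct)
    (auto intro!: vertical_growth_mult vertical_growth_const)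

lemma vertical_growth_affine:
  assumes "vertical_growth T r f" "\<And>x. x \<in> S \<Longrightarrow> B + k * x \<in> T"
  shows "vertical_growth S (r * \<bar>k\<bar>) (\<lambda>z. f (of_real B + of_real k * z))"
proof -
  obtain C n where C: "C \<ge> 0" "\<And>x y. x \<in> T \<Longrightarrow> cmod (f (Complex x y)) \<le> C * (1 + \<bar>y\<bar>) ^ n * exp (r * \<bar>y\<bar>)"
    using assms(1) unfolding vertical_growth_def by blast
  show ?thesis unfolding vertical_growth_def
  proof (intro exI conjI ballI allI)
    fix x y assume "x \<in> S"
    have "of_real B + of_real k * Complex x y = Complex (B + k * x) (k * y)"
      by (simp add: complex_eq_iff)
    then have "cmod (f (of_real B + of_real k * Complex x y)) \<le> C * (1 + \<bar>k * y\<bar>) ^ n * exp (r * \<bar>k * y\<bar>)"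
      using C(2)[OF assms(2)[OF \<open>x \<in> S\<close>]] by simp
    also have "\<dots> \<le> C * ((1 + \<bar>k\<bar>) * (1 + \<bar>y\<bar>)) ^ n * exp (r * \<bar>k * y\<bar>)"
      using C by (intro mult_right_mono mult_left_mono power_mono) (auto simp: algebra_simps abs_mult)
    finally show "cmod (f (of_real B + of_real k * Complex x y))
        \<le> (C * (1 + \<bar>k\<bar>) ^ n) * (1 + \<bar>y\<bar>) ^ n * exp (r * \<bar>k\<bar> * \<bar>y\<bar>)"
      by (simp add: power_mult_distrib mult_ac abs_mult)
  qed (use C in auto)
qed

lemma cmod_Complex_le: "cmod (Complex x y) \<le> \<bar>x\<bar> + \<bar>y\<bar>"
  using cmod_le[of "Complex x y"] by simp

lemma Gamma_bounded_on:
  assumes "0 < lo"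
  obtains G :: real where "0 < G" "\<And>x. x \<in> {lo..hi} \<Longrightarrow> Gamma x \<le> G"
proof -
  have "compact (Gamma ` {lo..hi})"
    using assms by (intro compact_continuous_image continuous_on_Gamma)
      (auto elim!: nonpos_Ints_cases)
  then obtain G where "\<And>x. x \<in> {lo..hi} \<Longrightarrow> \<bar>Gamma x\<bar> \<le> G"
    by (metis (no_types, lifting) bounded_real compact_imp_bounded imageI)
  then have "\<And>x. x \<in> {lo..hi} \<Longrightarrow> Gamma x \<le> max G 1" by (metis abs_le_D1 max.coboundedI1)
  then show ?thesis by (intro that[of "max G 1"]) auto
qed

text \<open>Monotonicity of the ratio bounds \<open>Gamma\<close> from above only by values further
  to the right. The comparison is therefore made at real part \<open>1/2 + n\<close>, beyond the
  strip, and the functional equation leads back to real part \<open>1/2\<close> at the price of a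
  Pochhammer factor, a polynomial of degree \<open>n\<close>.\<close>

lemma vertical_growth_Gamma:
  assumes "0 < lo"
  shows "vertical_growth {lo..hi} (- (pi/2)) Gamma"
proof -
  obtain G where G: "0 < G" "\<And>x. x \<in> {lo..hi} \<Longrightarrow> Gamma x \<le> G" using Gamma_bounded_on[OF assms, of hi] by blast
  obtain n :: nat where n: "hi \<le> real n" using real_arch_simple by blast
  have "cmod (Gamma (Complex x y))
    \<le> (G / Gamma (1/2 + real n) * sqrt (2*pi) * (real n + 1) ^ n) * (1 + \<bar>y\<bar>) ^ n * exp (- (pi/2) * \<bar>y\<bar>)"
    if x: "x \<in> {lo..hi}" for x y
  proof -
    have x0: "0 < x" "x \<le> 1/2 + real n" using x assms n by auto
    have Gn: "Gamma (1/2 + real n) > 0" by (intro Gamma_real_pos) auto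
    have half: "Complex (1/2) y \<notin> \<int>\<^sub>\<le>\<^sub>0"
      by (auto elim!: nonpos_Ints_cases simp: complex_eq_iff)
    have "Gamma (Complex (1/2 + real n) y) = pochhammer (Complex (1/2) y) n * Gamma (Complex (1/2) y)"
    proof -
      have "Complex (1/2 + real n) y = Complex (1/2) y + of_nat n" by (simp add: complex_eq_iff)
      then show ?thesis using pochhammer_Gamma[OF half, of n] half by (simp add: Gamma_eq_zero_iff)
    qed
    also have "cmod \<dots> \<le> ((real n + 1) * (1 + \<bar>y\<bar>)) ^ n * (sqrt (2*pi) * exp (- (pi/2) * \<bar>y\<bar>))"
      unfolding norm_mult
    proof (intro mult_mono norm_Gamma_half_bounds order.trans[OF norm_pochhammer_le] power_mono)
      have "0 \<le> real n * \<bar>y\<bar>" by simp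
      then show "cmod (Complex (1 / 2) y) + real n \<le> (real n + 1) * (1 + \<bar>y\<bar>)"
        using cmod_Complex_le[of "1/2" y] unfolding distrib_right distrib_left by linarith
    qed auto
    finally have shifted: "cmod (Gamma (Complex (1/2 + real n) y))
      \<le> ((real n + 1) * (1 + \<bar>y\<bar>)) ^ n * (sqrt (2*pi) * exp (- (pi/2) * \<bar>y\<bar>))" .
    have "cmod (Gamma (Complex x y)) \<le> Gamma x * (cmod (Gamma (Complex (1/2 + real n) y)) / Gamma (1/2 + real n))"
      using norm_Gamma_ratio_mono[OF x0, of y] Gamma_real_pos[OF x0(1)] by (simp add: field_simps)
    also have "\<dots> \<le> G * (cmod (Gamma (Complex (1/2 + real n) y)) / Gamma (1/2 + real n))"
      using G(2)[OF x] Gn by (intro mult_right_mono) auto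
    also have "\<dots> \<le> G * (((real n + 1) * (1 + \<bar>y\<bar>)) ^ n * (sqrt (2*pi) * exp (- (pi/2) * \<bar>y\<bar>)) / Gamma (1/2 + real n))"
      using G Gn by (intro mult_left_mono divide_right_mono shifted) auto
    finally show ?thesis by (simp add: power_mult_distrib mult_ac)
  qed
  moreover have "0 \<le> G / Gamma (1/2 + real n) * sqrt (2*pi) * (real n + 1) ^ n"
    using G Gamma_real_pos[of "1/2 + real n"] by (intro mult_nonneg_nonneg divide_nonneg_nonneg) auto
  ultimately show ?thesis unfolding vertical_growth_def by blast
qed

text \<open>Here the strip may reach into the left half plane, as the arguments
  \<open>a i + \<alpha> i - \<alpha> i * u\<close> do. Since \<open>rGamma\<close> is entire, a
  shift by \<open>n\<close> moves the strip to the right of \<open>1/2\<close> and costs only a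
  Pochhammer factor; there monotonicity bounds \<open>Gamma\<close> from below by its values on the
  line \<open>1/2\<close>.\<close>

lemma vertical_growth_rGamma: "vertical_growth {lo..hi} (pi/2) rGamma"
proof -
  obtain n :: nat where n: "1/2 - lo \<le> real n" using real_arch_simple by blast
  have "compact (rGamma ` {lo + real n..hi + real n})"
    by (intro compact_continuous_image continuous_on_rGamma) auto
  then obtain G where G: "\<And>x. x \<in> {lo + real n..hi + real n} \<Longrightarrow> \<bar>rGamma x\<bar> \<le> G"
    by (metis (no_types, lifting) bounded_real compact_imp_bounded imageI)
  define L where "L = max \<bar>lo\<bar> \<bar>hi\<bar>"
  have "cmod (rGamma (Complex x y)) \<le> ((1 + L + real n) ^ n * \<bar>G\<bar>) * (1 + \<bar>y\<bar>) ^ n * exp ((pi/2) * \<bar>y\<bar>)"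
    if x: "x \<in> {lo..hi}" for x y
  proof -
    let ?x = "x + real n"
    have x0: "1/2 \<le> ?x" "?x \<in> {lo + real n..hi + real n}" using x n by auto
    have "Complex x y + of_nat n = Complex ?x y" by (simp add: complex_eq_iff)
    then have "cmod (rGamma (Complex x y)) = cmod (pochhammer (Complex x y) n) * cmod (rGamma (Complex ?x y))"
      using pochhammer_rGamma[of "Complex x y" n] by (simp add: norm_mult)
    also have "\<dots> \<le> ((1 + L + real n) * (1 + \<bar>y\<bar>)) ^ n * (\<bar>G\<bar> * exp ((pi/2) * \<bar>y\<bar>))"
    proof (intro mult_mono order.trans[OF norm_pochhammer_le] power_mono)
      have "\<bar>x\<bar> \<le> L" "0 \<le> L" using x by (auto simp: L_def)
      moreover have "(1 + L + real n) * (1 + \<bar>y\<bar>) = 1 + L + real n + \<bar>y\<bar> + L * \<bar>y\<bar> + real n * \<bar>y\<bar>"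
        by (simp add: algebra_simps)
      moreover have "0 \<le> L * \<bar>y\<bar>" "0 \<le> real n * \<bar>y\<bar>" using \<open>0 \<le> L\<close> by auto
      ultimately show "cmod (Complex x y) + real n \<le> (1 + L + real n) * (1 + \<bar>y\<bar>)"
        using cmod_Complex_le[of x y] by linarith
      have Gx: "Gamma ?x > 0" using x0 by (intro Gamma_real_pos) auto
      have "sqrt pi * exp (- (pi/2) * \<bar>y\<bar>) / sqrt pi \<le> cmod (Gamma (Complex (1/2) y)) / Gamma (1/2)"
        unfolding Gamma_one_half_real by (intro divide_right_mono norm_Gamma_half_bounds) auto
      also have "\<dots> \<le> cmod (Gamma (Complex ?x y)) / Gamma ?x"
        using x0 by (intro norm_Gamma_ratio_mono) auto
      finally have "exp (- (pi/2) * \<bar>y\<bar>) * Gamma ?x \<le> cmod (Gamma (Complex ?x y))"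
        using Gx by (simp add: field_simps)
      moreover have "0 < exp (- (pi/2) * \<bar>y\<bar>) * Gamma ?x" using Gx by simp
      ultimately have "cmod (rGamma (Complex ?x y)) \<le> inverse (exp (- (pi/2) * \<bar>y\<bar>) * Gamma ?x)"
        unfolding rGamma_inverse_Gamma norm_inverse by (rule le_imp_inverse_le)
      also have "\<dots> = rGamma ?x * exp ((pi/2) * \<bar>y\<bar>)"
        by (simp add: rGamma_inverse_Gamma exp_minus)
      also have "\<dots> \<le> \<bar>G\<bar> * exp ((pi/2) * \<bar>y\<bar>)"
        using G[OF x0(2)] by (intro mult_right_mono) auto
      finally show "cmod (rGamma (Complex ?x y)) \<le> \<bar>G\<bar> * exp ((pi/2) * \<bar>y\<bar>)" .
    qed (auto simp: L_def)
    finally show ?thesis by (simp add: power_mult_distrib mult_ac)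
  qed
  moreover have "0 \<le> (1 + L + real n) ^ n * \<bar>G\<bar>" by (auto simp: L_def)
  ultimately show ?thesis unfolding vertical_growth_def by blast
qed

section \<open>Decay of the Wright function\<close>

text \<open>A primitive \<open>F\<close> on the convex set takes the place of Cauchy's theorem for
  rectangles: integrals over vertical segments are differences of values of \<open>F\<close>, and
  the change of \<open>F\<close> along a horizontal edge at height \<open>y\<close> is at most the
  decay bound times \<open>d - c\<close>, which tends to 0.\<close>

lemma vertical_line_shift:
  assumes S: "open S" "convex S" and f: "f holomorphic_on S"
    and cd: "c \<le> d" and strip: "\<And>x y. c \<le> x \<Longrightarrow> x \<le> d \<Longrightarrow> Complex x y \<in> S"
    and decay: "\<And>x y. c \<le> x \<Longrightarrow> x \<le> d \<Longrightarrow> cmod (f (Complex x y)) \<le> C / (1 + y\<^sup>2)"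
  shows "(LINT y|lborel. f (Complex c y)) = (LINT y|lborel. f (Complex d y))"
proof -
  obtain F where F: "\<And>z. z \<in> S \<Longrightarrow> (F has_field_derivative f z) (at z within S)"
    using holomorphic_convex_primitive'[OF S(2,1) f] by blast
  have line: "(\<lambda>y. f (Complex x y)) \<in> borel_measurable borel \<and> integrable lborel (\<lambda>y. f (Complex x y))
      \<and> (\<lambda>n. F (Complex x (real n)) - F (Complex x (- real n))) \<longlonglongrightarrow> \<i> * (LINT y|lborel. f (Complex x y))"
    if x: "c \<le> x" "x \<le> d" for x
  proof -
    have cont: "continuous_on UNIV (\<lambda>y. f (Complex x y))"
      by (rule continuous_on_compose2[OF holomorphic_on_imp_continuous_on[OF f]])
         (use strip x in \<open>auto intro!: continuous_intros simp: Complex_eq\<close>)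
    then have meas: "(\<lambda>y. f (Complex x y)) \<in> borel_measurable borel"
      by (rule borel_measurable_continuous_onI)
    have int: "integrable lborel (\<lambda>y. f (Complex x y))"
      by (rule Bochner_Integration.integrable_bound[OF integrable_mult_left[OF integrable_inverse_1_plus_square_lborel, of C]])
         (use meas in \<open>auto simp: divide_inverse mult.commute abs_mult intro!: AE_I2 order.trans[OF decay[OF x]] mult_right_mono\<close>)
    have eq: "F (Complex x (real n)) - F (Complex x (- real n)) = \<i> * (LINT y:{-real n..real n}|lborel. f (Complex x y))" for n
    proof -
      have "((\<lambda>y. \<i> * f (Complex x y)) has_integral F (Complex x (real n)) - F (Complex x (- real n))) {-real n..real n}"
      proof (rule fundamental_theorem_of_calculus)
        fix y assume "y \<in> {-real n..real n}"
        have D: "(F has_field_derivative f (Complex x y)) (at (Complex x y))"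
          using F[OF strip[OF x]] S(1) strip[OF x] by (metis at_within_open)
        have "((\<lambda>y. Complex x y) has_vector_derivative \<i>) (at y)"
          unfolding Complex_eq has_vector_derivative_def
          by (auto intro!: derivative_eq_intros simp: scaleR_conv_of_real mult.commute)
        from field_vector_diff_chain_at[OF this D]
        show "((\<lambda>y. F (Complex x y)) has_vector_derivative \<i> * f (Complex x y)) (at y within {-real n..real n})"
          by (simp add: o_def has_vector_derivative_at_within)
      qed simp
      moreover have "set_integrable lborel {-real n..real n} (\<lambda>y. \<i> * f (Complex x y))"
        unfolding set_integrable_def by (intro integrable_mult_indicator integrable_mult_right int) auto
      from set_borel_integral_eq_integral(2)[OF this] set_borel_integral_eq_integral(1)[OF this]
      have "((\<lambda>y. \<i> * f (Complex x y)) has_integral (LINT y:{-real n..real n}|lborel. \<i> * f (Complex x y))) {-real n..real n}"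
        by (metis integrable_integral)
      ultimately show ?thesis by (auto dest: has_integral_unique)
    qed
    have "(\<lambda>n. LINT y|lborel. indicator {-real n..real n} y *\<^sub>R f (Complex x y)) \<longlonglongrightarrow> (LINT y|lborel. f (Complex x y))"
    proof (rule integral_dominated_convergence[where w = "\<lambda>y. cmod (f (Complex x y))"])
      show "AE y in lborel. (\<lambda>n. indicator {-real n..real n} y *\<^sub>R f (Complex x y)) \<longlonglongrightarrow> f (Complex x y)"
      proof (intro AE_I2 tendsto_eventually)
        fix y :: real
        obtain k :: nat where "\<bar>y\<bar> \<le> real k" using real_arch_simple by blast
        then show "\<forall>\<^sub>F n in sequentially. indicator {-real n..real n} y *\<^sub>R f (Complex x y) = f (Complex x y)"
          by (intro eventually_sequentiallyI[of k]) (auto simp: indicator_def)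
      qed
    qed (use meas int in \<open>auto simp: indicator_def\<close>)
    then have "(\<lambda>n. F (Complex x (real n)) - F (Complex x (- real n))) \<longlonglongrightarrow> \<i> * (LINT y|lborel. f (Complex x y))"
      unfolding eq set_lebesgue_integral_def by (intro tendsto_intros)
    with meas int show ?thesis by blast
  qed
  have edge: "cmod (F (Complex d y) - F (Complex c y)) \<le> C / (1 + y\<^sup>2) * (d - c)" for y
  proof -
    have "cmod (F (Complex d y) - F (Complex c y)) \<le> C / (1 + y\<^sup>2) * cmod (Complex d y - Complex c y)"
    proof (rule field_differentiable_bound[of "closed_segment (Complex c y) (Complex d y)" F f])
      fix z assume "z \<in> closed_segment (Complex c y) (Complex d y)"
      then obtain u where u: "0 \<le> u" "u \<le> 1" "z = (1 - u) *\<^sub>R Complex c y + u *\<^sub>R Complex d y"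
        by (auto simp: in_segment)
      then have z: "z = Complex (c + u * (d - c)) y" by (simp add: complex_eq_iff algebra_simps)
      have "0 \<le> u * (d - c)" "u * (d - c) \<le> 1 * (d - c)"
        using u cd by (intro mult_nonneg_nonneg mult_right_mono; simp)+
      then have x: "c \<le> c + u * (d - c)" "c + u * (d - c) \<le> d" by auto
      show "cmod (f z) \<le> C / (1 + y\<^sup>2)" unfolding z by (rule decay[OF x])
      have "(F has_field_derivative f z) (at z)"
        unfolding z using F[OF strip[OF x]] S(1) strip[OF x] by (metis at_within_open)
      then show "(F has_field_derivative f z) (at z within closed_segment (Complex c y) (Complex d y))"
        by (rule has_field_derivative_at_within)
    qed auto
    also have "Complex d y - Complex c y = of_real (d - c)" by (simp add: complex_eq_iff)
    finally show ?thesis using cd by (simp del: of_real_diff)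
  qed
  have edge_lim: "(\<lambda>n. F (Complex d (s * real n)) - F (Complex c (s * real n))) \<longlonglongrightarrow> 0"
    if "s = 1 \<or> s = -1" for s :: real
  proof (rule tendsto_norm_zero_cancel, rule tendsto_sandwich[OF _ _ tendsto_const])
    show "\<forall>\<^sub>F n in sequentially. cmod (F (Complex d (s * real n)) - F (Complex c (s * real n)))
        \<le> C / (1 + (real n)\<^sup>2) * (d - c)"
      using edge[of "s * real n" for n] that by (intro always_eventually) (auto simp: power2_eq_square)
    show "(\<lambda>n. C / (1 + (real n)\<^sup>2) * (d - c)) \<longlonglongrightarrow> 0" by real_asymp
  qed auto
  have "(\<lambda>n. (F (Complex d (real n)) - F (Complex d (- real n))) - (F (Complex c (real n)) - F (Complex c (- real n)))) \<longlonglongrightarrow> 0"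
    using tendsto_diff[OF edge_lim[of 1] edge_lim[of "-1"]] by (simp add: algebra_simps)
  moreover have "(\<lambda>n. (F (Complex d (real n)) - F (Complex d (- real n))) - (F (Complex c (real n)) - F (Complex c (- real n)))) \<longlonglongrightarrow>
      \<i> * (LINT y|lborel. f (Complex d y)) - \<i> * (LINT y|lborel. f (Complex c y))"
    using line[of c] line[of d] cd by (intro tendsto_diff) auto
  ultimately have "\<i> * (LINT y|lborel. f (Complex d y)) - \<i> * (LINT y|lborel. f (Complex c y)) = 0"
    using LIMSEQ_unique by blast
  then show ?thesis by simp
qed

lemma vertical_growth_imp_quadratic_decay:
  assumes "vertical_growth S r f" "r \<le> - (pi/2)"
  obtains C where "C \<ge> 0" "\<And>x y. x \<in> S \<Longrightarrow> cmod (f (Complex x y)) \<le> C / (1 + y\<^sup>2)"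
proof -
  obtain C n where C: "C \<ge> 0" "\<And>x y. x \<in> S \<Longrightarrow> cmod (f (Complex x y)) \<le> C * (1 + \<bar>y\<bar>) ^ n * exp (r * \<bar>y\<bar>)"
    using assms(1) unfolding vertical_growth_def by blast
  have "cmod (f (Complex x y)) \<le> (C * fact (n + 2) * exp 1) / (1 + y\<^sup>2)" if "x \<in> S" for x y
  proof -
    have "(1 + \<bar>y\<bar>) ^ (n + 2) / fact (n + 2) \<le> exp (1 + \<bar>y\<bar>)"
    proof -
      let ?t = "1 + \<bar>y\<bar>"
      \<comment> \<open>A single term of the exponential series already dominates the power.\<close>
      have "sum (\<lambda>k. ?t ^ k /\<^sub>R fact k) {n + 2} \<le> (\<Sum>k. ?t ^ k /\<^sub>R fact k)"
        by (intro sum_le_suminf summable_exp_generic) auto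
      then show ?thesis by (simp add: exp_def field_simps)
    qed
    then have 1: "(1 + \<bar>y\<bar>) ^ (n + 2) \<le> fact (n + 2) * exp (1 + \<bar>y\<bar>)"
      by (simp add: divide_le_eq mult.commute)
    \<comment> \<open>As \<open>pi/2 > 1\<close>, the factor \<open>exp (- \<bar>y\<bar>)\<close> is
      available; it reduces \<open>exp (1 + \<bar>y\<bar>)\<close> to the constant
      \<open>exp 1\<close>.\<close>
    have "r * \<bar>y\<bar> \<le> -1 * \<bar>y\<bar>" using assms(2) pi_gt3 by (intro mult_right_mono) auto
    then have 2: "exp (r * \<bar>y\<bar>) \<le> exp (- \<bar>y\<bar>)" by simp
    have "1 + y\<^sup>2 \<le> (1 + \<bar>y\<bar>)\<^sup>2" by (simp add: power2_eq_square algebra_simps)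
    then have "cmod (f (Complex x y)) * (1 + y\<^sup>2)
        \<le> (C * (1 + \<bar>y\<bar>) ^ n * exp (r * \<bar>y\<bar>)) * (1 + \<bar>y\<bar>)\<^sup>2"
      using C(1) C(2)[OF that, of y] by (intro mult_mono) auto
    also have "\<dots> = C * ((1 + \<bar>y\<bar>) ^ (n+2) * exp (r * \<bar>y\<bar>))" by (simp add: power_add power2_eq_square)
    also have "\<dots> \<le> C * ((fact (n + 2) * exp (1 + \<bar>y\<bar>)) * exp (- \<bar>y\<bar>))"
      using C(1) 1 2 by (intro mult_left_mono mult_mono) auto
    also have "\<dots> = C * fact (n + 2) * exp 1" by (simp flip: exp_add)
    finally show ?thesis by (simp add: pos_le_divide_eq add_pos_nonneg)
  qed
  then show ?thesis using C by (intro that[of "C * fact (n + 2) * exp 1"]) auto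
qed

lemma norm_wright_neg_le:
  assumes A: "\<forall>i\<in>{1..p}. \<alpha> i > 0"
    and B: "\<forall>j\<in>{1..m}. \<beta> j > 0"
    and a_star: "fox_a_star m p \<alpha> \<beta> \<ge> 0"
    and c: "0 < c" "\<forall>j\<in>{1..m}. c < (b j + \<beta> j) / \<beta> j"
    and strip: "\<forall>j\<in>{1..m}. 2 * b j + \<beta> j > 0"
  obtains C q where "C \<ge> 0" "1/2 < q"
    "\<And>s. s > 0 \<Longrightarrow> cmod (wright_neg c m p a \<alpha> b \<beta> s) \<le> C * s powr (-q)"
proof -
  \<comment> \<open>The inserted element keeps \<open>D\<close> nonempty when \<open>m = 0\<close>;
    it exceeds \<open>max c (1/2)\<close>, so the lower bound on \<open>Min D\<close> is unaffected
    by it.\<close>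
  define D where "D = insert (max c (1/2) + 1) ((\<lambda>j. (b j + \<beta> j) / \<beta> j) ` {1..m})"
  have "max c (1/2) < Min D"
    unfolding D_def using c strip B by (subst Min_gr_iff) (auto simp: field_simps)
  then obtain q where "max c (1/2) < q" "q < Min D" using dense by blast
  then have q: "c \<le> q" "1/2 < q" "\<And>j. j \<in> {1..m} \<Longrightarrow> q < (b j + \<beta> j) / \<beta> j"
    by (auto simp: D_def Min_gr_iff)
  define g where "g u = Gamma u
        * ((\<Prod>j=1..m. Gamma (of_real (b j + \<beta> j) - of_real (\<beta> j) * u))
           / (\<Prod>i=1..p. Gamma (of_real (a i + \<alpha> i) - of_real (\<alpha> i) * u)))" for u :: complex
  \<comment> \<open>With \<open>rGamma\<close> the denominator becomes an entire factor, so
    holomorphy requires avoiding only the poles of the numerator.\<close>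
  have g_eq: "g u = Gamma u
        * ((\<Prod>j=1..m. Gamma (of_real (b j + \<beta> j) + of_real (- \<beta> j) * u))
           * (\<Prod>i=1..p. rGamma (of_real (a i + \<alpha> i) + of_real (- \<alpha> i) * u)))" for u
    unfolding g_def rGamma_inverse_Gamma prod_inversef[symmetric] o_def divide_inverse by simp
  have "vertical_growth {c..q} (- (pi/2) + ((\<Sum>j=1..m. - (pi/2) * \<bar>- \<beta> j\<bar>) + (\<Sum>i=1..p. (pi/2) * \<bar>- \<alpha> i\<bar>))) g"
    unfolding g_eq
  proof (intro vertical_growth_mult vertical_growth_prod vertical_growth_Gamma c(1))
    fix j assume j: "j \<in> {1..m}"
    then have \<beta>: "\<beta> j > 0" using B by auto
    show "vertical_growth {c..q} (- (pi/2) * \<bar>- \<beta> j\<bar>) (\<lambda>u. Gamma (of_real (b j + \<beta> j) + of_real (- \<beta> j) * u))"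
    proof (rule vertical_growth_affine[OF vertical_growth_Gamma])
      show "0 < b j + \<beta> j - \<beta> j * q" using q(3)[OF j] \<beta> by (simp add: field_simps)
      show "b j + \<beta> j + - \<beta> j * x \<in> {b j + \<beta> j - \<beta> j * q..b j + \<beta> j - \<beta> j * c}" if "x \<in> {c..q}" for x
        using that \<beta> by (auto intro: mult_left_mono)
    qed
  next
    fix i assume i: "i \<in> {1..p}"
    then have \<alpha>: "\<alpha> i > 0" using A by auto
    show "vertical_growth {c..q} ((pi/2) * \<bar>- \<alpha> i\<bar>) (\<lambda>u. rGamma (of_real (a i + \<alpha> i) + of_real (- \<alpha> i) * u))"
    proof (rule vertical_growth_affine[OF vertical_growth_rGamma])
      show "a i + \<alpha> i + - \<alpha> i * x \<in> {a i + \<alpha> i - \<alpha> i * q..a i + \<alpha> i - \<alpha> i * c}" if "x \<in> {c..q}" for x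
        using that \<alpha> by (auto intro: mult_left_mono)
    qed
  qed auto
  \<comment> \<open>The numerator and denominator rates combine to
    \<open>- (pi/2) * fox_a_star m p \<alpha> \<beta>\<close>, which is at most 0; what remains is
    the rate of \<open>Gamma u\<close>.\<close>
  moreover have "- (pi/2) + ((\<Sum>j=1..m. - (pi/2) * \<bar>- \<beta> j\<bar>) + (\<Sum>i=1..p. (pi/2) * \<bar>- \<alpha> i\<bar>)) \<le> - (pi/2)"
  proof -
    have "(\<Sum>j=1..m. - (pi/2) * \<bar>- \<beta> j\<bar>) = - (pi/2) * (\<Sum>j=1..m. \<beta> j)"
      unfolding sum_distrib_left using B by (intro sum.cong) (auto simp: abs_of_pos)
    moreover have "(\<Sum>i=1..p. (pi/2) * \<bar>- \<alpha> i\<bar>) = (pi/2) * (\<Sum>i=1..p. \<alpha> i)"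
      unfolding sum_distrib_left using A by (intro sum.cong) (auto simp: abs_of_pos)
    moreover have "(pi/2) * (\<Sum>i=1..p. \<alpha> i) \<le> (pi/2) * (\<Sum>j=1..m. \<beta> j)"
      using a_star unfolding fox_a_star_def by (intro mult_left_mono) auto
    ultimately show ?thesis by simp
  qed
  ultimately obtain G where G: "G \<ge> 0" "\<And>x y. x \<in> {c..q} \<Longrightarrow> cmod (g (Complex x y)) \<le> G / (1 + y\<^sup>2)"
    using vertical_growth_imp_quadratic_decay by blast
  define S where "S = {u. 0 < Re u} \<inter> (\<Inter>j\<in>{1..m}. {u. Re u < (b j + \<beta> j) / \<beta> j})"
  have S: "open S" "convex S"
    unfolding S_def by (auto intro!: open_Int open_INT open_halfspace_Re_gt open_halfspace_Re_lt
        convex_Int convex_INT convex_halfspace_Re_gt convex_halfspace_Re_lt)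
  have nonpole: "z \<notin> \<int>\<^sub>\<le>\<^sub>0" if "0 < Re z" for z :: complex
    using that by (auto elim!: nonpos_Ints_cases)
  have hol: "g holomorphic_on S"
    unfolding g_eq
  proof (intro holomorphic_intros)
    show "S \<inter> \<int>\<^sub>\<le>\<^sub>0 = {}"
      by (auto simp: S_def elim!: nonpos_Ints_cases)
    show "of_real (b j + \<beta> j) + of_real (- \<beta> j) * u \<notin> \<int>\<^sub>\<le>\<^sub>0" if "j \<in> {1..m}" "u \<in> S" for j u
    proof -
      have "0 < Re (of_real (b j + \<beta> j) + of_real (- \<beta> j) * u)"
        using that B by (auto simp: S_def field_simps)
      then show ?thesis by (rule nonpole)
    qed
  qed
  define I where "I = (LINT y|lborel. inverse (1 + (y::real)\<^sup>2))"
  show ?thesis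
  proof (rule that[of "1 / (2 * pi) * (G * I)" q])
    fix s :: real assume s: "s > 0"
    define f where "f u = g u * of_real s powr (- u)" for u :: complex
    have norm_f: "cmod (f (Complex x y)) = cmod (g (Complex x y)) * s powr (- x)" for x y
      using s by (simp add: f_def norm_mult norm_powr_real_powr)
    have shift: "(LINT y|lborel. f (Complex c y)) = (LINT y|lborel. f (Complex q y))"
    proof (rule vertical_line_shift[OF S _ q(1), where C = "G * (s powr (- c) + s powr (- q))"])
      show "f holomorphic_on S"
        unfolding f_def using s by (intro holomorphic_intros hol) auto
      show "Complex x y \<in> S" if "c \<le> x" "x \<le> q" for x y
        using that c(1) q(3) unfolding S_def by fastforce
      show "cmod (f (Complex x y)) \<le> G * (s powr (- c) + s powr (- q)) / (1 + y\<^sup>2)" if "c \<le> x" "x \<le> q" for x y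
      proof -
        \<comment> \<open>The bound has to be uniform over the strip. The power is largest at one of
          the two edges, at \<open>c\<close> for \<open>s \<ge> 1\<close> and at \<open>q\<close>
          for \<open>s < 1\<close>, and the sum covers both.\<close>
        have "s powr (- x) \<le> s powr (- c) + s powr (- q)"
        proof (cases "s \<ge> 1")
          case True
          then have "s powr (- x) \<le> s powr (- c)" using that by (intro powr_mono) auto
          then show ?thesis by (simp add: add_increasing2)
        next
          case False
          then have "s powr (- x) \<le> s powr (- q)" using that s by (intro powr_mono') auto
          then show ?thesis by (simp add: add_increasing)
        qed
        then have "cmod (f (Complex x y)) \<le> G / (1 + y\<^sup>2) * (s powr (- c) + s powr (- q))"
          unfolding norm_f using that G by (intro mult_mono) auto
        then show ?thesis by simp
      qed
    qed
    have "cmod (LINT y|lborel. f (Complex q y)) \<le> (LINT y|lborel. G * s powr (- q) * inverse (1 + y\<^sup>2))"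
    proof (rule order.trans[OF integral_norm_bound], rule integral_mono_AE')
      show "AE y in lborel. cmod (f (Complex q y)) \<le> G * s powr (- q) * inverse (1 + y\<^sup>2)"
        unfolding norm_f using mult_right_mono[OF G(2)[of q], of "s powr (- q)"] q(1)
        by (intro AE_I2) (simp add: field_simps)
    qed (use G in \<open>auto intro!: integrable_mult_right integrable_inverse_1_plus_square_lborel AE_I2 mult_nonneg_nonneg\<close>)
    also have "\<dots> = G * s powr (- q) * I" by (simp add: I_def)
    finally have "cmod (1 / (2 * of_real pi * \<i>) * (LINT y|lborel. f (Complex c y) * \<i>)) \<le> 1 / (2 * pi) * (G * s powr (- q) * I)"
      unfolding integral_mult_left_zero shift by (simp add: norm_mult norm_divide divide_right_mono)
    then show "cmod (wright_neg c m p a \<alpha> b \<beta> s) \<le> 1 / (2 * pi) * (G * I) * s powr (- q)"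
      using s unfolding wright_neg_def vertical_integral_def f_def g_def by (simp add: mult_ac)
  qed (use G q in \<open>auto simp: I_def intro!: mult_nonneg_nonneg Bochner_Integration.integral_nonneg\<close>)
qed

section \<open>Measures of bounded Gaussian energy\<close>

lemma nn_integral_lborel_shift:
  fixes f :: "real \<Rightarrow> ennreal"
  assumes [measurable]: "f \<in> borel_measurable borel"
  shows "(\<integral>\<^sup>+z. f (z + y) \<partial>lborel) = (\<integral>\<^sup>+z. f z \<partial>lborel)"
  using nn_integral_real_affine[OF assms, of 1 y] by (simp add: add.commute)

text \<open>This is the origin of the scale \<open>sqrt 2 * \<sigma>\<close> in the energies: the
  kernel at that scale is the kernel at scale \<sigma> convolved with itself.\<close>

lemma nn_integral_normal_density_convolution:
  assumes "\<sigma> > 0"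
  shows "(\<integral>\<^sup>+z. ennreal (normal_density 0 \<sigma> (x - z)) * ennreal (normal_density 0 \<sigma> (y - z)) \<partial>lborel)
    = ennreal (normal_density 0 (sqrt 2 * \<sigma>) (x - y))"
proof -
  have "(\<integral>\<^sup>+z. ennreal (normal_density 0 \<sigma> (x - z)) * ennreal (normal_density 0 \<sigma> (y - z)) \<partial>lborel)
     = (\<integral>\<^sup>+z. ennreal (normal_density 0 \<sigma> (x - (z + y))) * ennreal (normal_density 0 \<sigma> (y - (z + y))) \<partial>lborel)"
    by (rule nn_integral_lborel_shift[symmetric]) measurable
  also have "\<dots> = (\<integral>\<^sup>+z. ennreal (normal_density 0 \<sigma> ((x - y) - z) * normal_density 0 \<sigma> z) \<partial>lborel)"
    by (intro nn_integral_cong) (simp add: normal_density_def ennreal_mult[symmetric] algebra_simps)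
  also have "\<dots> = ennreal (normal_density 0 (sqrt (\<sigma>\<^sup>2 + \<sigma>\<^sup>2)) (x - y))"
    using conv_normal_density_zero_mean[OF assms assms] by (rule fun_cong)
  also have "sqrt (\<sigma>\<^sup>2 + \<sigma>\<^sup>2) = sqrt 2 * \<sigma>"
    using assms by (simp add: real_sqrt_mult flip: mult_2)
  finally show ?thesis .
qed

lemma le_ennreal_sqrtI:
  assumes "J\<^sup>2 \<le> ennreal c" "0 \<le> c"
  shows "J \<le> ennreal (sqrt c)"
proof (cases J)
  case (real r)
  then have "r\<^sup>2 \<le> c" using assms by (simp add: ennreal_power)
  then show ?thesis using real by (auto intro: real_le_rsqrt ennreal_leI)
qed (use assms in \<open>auto simp: top_unique\<close>)

text \<open>The substitution \<open>z = x + \<sigma> n * w\<close> puts all scales under one fixed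
  Gaussian weight, after which Fatou's lemma applies. One inequality is all that the duality
  argument for \<open>\<mu>\<close> asks for.\<close>

lemma nn_integral_le_of_approx_identity:
  fixes \<psi> :: "real \<Rightarrow> real" and \<sigma> :: "nat \<Rightarrow> real"
  assumes cont: "continuous_on UNIV \<psi>" and nonneg: "\<And>x. 0 \<le> \<psi> x"
    and \<sigma>: "\<And>n. 0 < \<sigma> n" "\<sigma> \<longlonglongrightarrow> 0"
  shows "ennreal (\<psi> x) \<le> liminf (\<lambda>n. \<integral>\<^sup>+z. ennreal (\<psi> z) * ennreal (normal_density 0 (\<sigma> n) (x - z)) \<partial>lborel)"
proof -
  have [measurable]: "\<psi> \<in> borel_measurable borel"
    using cont by (rule borel_measurable_continuous_onI)
  have "(\<integral>\<^sup>+z. ennreal (\<psi> z) * ennreal (normal_density 0 (\<sigma> n) (x - z)) \<partial>lborel)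
    = (\<integral>\<^sup>+w. ennreal (\<psi> (x + \<sigma> n * w)) * ennreal (std_normal_density w) \<partial>lborel)" for n
  proof -
    have "(\<integral>\<^sup>+z. ennreal (\<psi> z) * ennreal (normal_density 0 (\<sigma> n) (x - z)) \<partial>lborel)
      = ennreal \<bar>\<sigma> n\<bar> * (\<integral>\<^sup>+w. ennreal (\<psi> (x + \<sigma> n * w)) * ennreal (normal_density 0 (\<sigma> n) (x - (x + \<sigma> n * w))) \<partial>lborel)"
      using \<sigma>(1)[of n] by (intro nn_integral_real_affine) auto
    also have "\<dots> = (\<integral>\<^sup>+w. ennreal \<bar>\<sigma> n\<bar> * (ennreal (\<psi> (x + \<sigma> n * w)) * ennreal (normal_density 0 (\<sigma> n) (x - (x + \<sigma> n * w)))) \<partial>lborel)"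
      by (rule nn_integral_cmult[symmetric]) measurable
    also have "\<dots> = (\<integral>\<^sup>+w. ennreal (\<psi> (x + \<sigma> n * w)) * ennreal (std_normal_density w) \<partial>lborel)"
    proof (rule nn_integral_cong)
      fix w
      have "\<sigma> n * normal_density 0 (\<sigma> n) (x - (x + \<sigma> n * w)) = std_normal_density w"
        using \<sigma>(1)[of n] by (simp add: normal_density_def real_sqrt_mult power_mult_distrib)
      then show "ennreal \<bar>\<sigma> n\<bar> * (ennreal (\<psi> (x + \<sigma> n * w)) * ennreal (normal_density 0 (\<sigma> n) (x - (x + \<sigma> n * w))))
        = ennreal (\<psi> (x + \<sigma> n * w)) * ennreal (std_normal_density w)"
        using \<sigma>(1)[of n] nonneg by (simp add: ennreal_mult[symmetric] mult.left_commute)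
    qed
    finally show ?thesis .
  qed
  moreover have "ennreal (\<psi> x) = (\<integral>\<^sup>+w. liminf (\<lambda>n. ennreal (\<psi> (x + \<sigma> n * w)) * ennreal (std_normal_density w)) \<partial>lborel)"
  proof -
    have "(\<lambda>n. ennreal (\<psi> (x + \<sigma> n * w)) * ennreal (std_normal_density w)) \<longlonglongrightarrow> ennreal (\<psi> x) * ennreal (std_normal_density w)" for w
      unfolding ennreal_mult'[OF nonneg, symmetric]
    proof (intro tendsto_mult tendsto_ennrealI tendsto_const)
      have "(\<lambda>n. x + \<sigma> n * w) \<longlonglongrightarrow> x + 0 * w" by (intro tendsto_intros \<sigma>)
      then show "(\<lambda>n. \<psi> (x + \<sigma> n * w)) \<longlonglongrightarrow> \<psi> x"
        using cont by (auto simp: continuous_on_eq_continuous_at intro!: isCont_tendsto_compose[of x \<psi>])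
    qed
    then have "(\<integral>\<^sup>+w. liminf (\<lambda>n. ennreal (\<psi> (x + \<sigma> n * w)) * ennreal (std_normal_density w)) \<partial>lborel)
      = (\<integral>\<^sup>+w. ennreal (\<psi> x) * ennreal (std_normal_density w) \<partial>lborel)"
      by (intro nn_integral_cong lim_imp_Liminf) auto
    also have "\<dots> = ennreal (\<psi> x) * (\<integral>\<^sup>+w. ennreal (std_normal_density w) \<partial>lborel)"
      by (rule nn_integral_cmult) measurable
    also have "(\<integral>\<^sup>+w. ennreal (std_normal_density w) \<partial>lborel) = 1"
      by (subst nn_integral_eq_integral) auto
    finally show ?thesis by simp
  qed
  ultimately show ?thesis by (simp add: nn_integral_liminf)
qed

lemma liminf_le_const:
  fixes f :: "nat \<Rightarrow> ennreal"
  assumes "\<And>n. f n \<le> C"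
  shows "liminf f \<le> C"
  using Liminf_mono[of f "\<lambda>_. C" sequentially] assms by (simp add: Liminf_const)

text \<open>The scales form an arbitrary null sequence because the theorem supplies a subsequence
  that varies with the path.\<close>

locale gaussian_energy =
  fixes \<mu> :: "real measure" and \<sigma> :: "nat \<Rightarrow> real" and B :: real
  assumes fin: "finite_measure \<mu>" and sets_eq [measurable_cong, simp]: "sets \<mu> = sets borel"
    and \<sigma>: "\<And>n. 0 < \<sigma> n" "\<sigma> \<longlonglongrightarrow> 0" and B: "0 \<le> B"
    and energy: "\<And>n. (\<integral>\<^sup>+x. \<integral>\<^sup>+y. ennreal (normal_density 0 (sqrt 2 * \<sigma> n) (x - y)) \<partial>\<mu> \<partial>\<mu>) \<le> ennreal B"
begin

lemma space_eq [simp]: "space \<mu> = UNIV"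
  using sets_eq_imp_space_eq[OF sets_eq] by simp

interpretation \<mu>: finite_measure \<mu> by (rule fin)
interpretation L\<mu>: pair_sigma_finite lborel \<mu> ..
interpretation \<mu>\<mu>: pair_sigma_finite \<mu> \<mu> ..

text \<open>Duality: \<psi> is integrated against \<open>\<mu>\<close> smoothed at scale
  \<open>\<sigma> n\<close>, and Cauchy--Schwarz separates the L2 norm of \<psi> from that of the
  smoothed measure, whose square is the energy. Continuity gives convergence at every point;
  convergence almost everywhere would not do while \<open>\<mu>\<close> might still charge Lebesgue
  null sets.\<close>

lemma nn_integral_continuous_le:
  assumes cont: "continuous_on UNIV \<psi>" and nonneg: "\<And>x. 0 \<le> \<psi> x"
    and P: "(\<integral>\<^sup>+x. (ennreal (\<psi> x))\<^sup>2 \<partial>lborel) \<le> ennreal P" "0 \<le> P"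
  shows "(\<integral>\<^sup>+x. ennreal (\<psi> x) \<partial>\<mu>) \<le> ennreal (sqrt (P * B))"
proof -
  have [measurable]: "\<psi> \<in> borel_measurable borel"
    using cont by (rule borel_measurable_continuous_onI)
  let ?k = "\<lambda>n x. ennreal (normal_density 0 (\<sigma> n) x)"
  define J where "J n = (\<integral>\<^sup>+x. \<integral>\<^sup>+z. ennreal (\<psi> z) * ?k n (x - z) \<partial>lborel \<partial>\<mu>)" for n
  have "J n \<le> ennreal (sqrt (P * B))" for n
  proof (rule le_ennreal_sqrtI)
    define q where "q z = (\<integral>\<^sup>+x. ?k n (x - z) \<partial>\<mu>)" for z
    have [measurable]: "q \<in> borel_measurable borel" unfolding q_def by measurable
    have "J n = (\<integral>\<^sup>+z. \<integral>\<^sup>+x. ennreal (\<psi> z) * ?k n (x - z) \<partial>\<mu> \<partial>lborel)"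
      unfolding J_def by (rule L\<mu>.Fubini') measurable
    also have "\<dots> = (\<integral>\<^sup>+z. ennreal (\<psi> z) * q z \<partial>lborel)"
      unfolding q_def by (intro nn_integral_cong nn_integral_cmult) measurable
    finally have "(J n)\<^sup>2 \<le> (\<integral>\<^sup>+z. (ennreal (\<psi> z))\<^sup>2 \<partial>lborel) * (\<integral>\<^sup>+z. (q z)\<^sup>2 \<partial>lborel)"
      by (simp add: Cauchy_Schwarz_nn_integral)
    \<comment> \<open>The square of an integral is a double integral; integrating \<open>z\<close>
      out first turns the product of kernels into the energy kernel.\<close>
    also have "(\<integral>\<^sup>+z. (q z)\<^sup>2 \<partial>lborel) = (\<integral>\<^sup>+z. \<integral>\<^sup>+x. \<integral>\<^sup>+y. ?k n (x - z) * ?k n (y - z) \<partial>\<mu> \<partial>\<mu> \<partial>lborel)"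
      unfolding q_def power2_eq_square
      by (simp add: nn_integral_cmult nn_integral_multc)
    also have "\<dots> = (\<integral>\<^sup>+x. \<integral>\<^sup>+z. \<integral>\<^sup>+y. ?k n (x - z) * ?k n (y - z) \<partial>\<mu> \<partial>lborel \<partial>\<mu>)"
      by (rule L\<mu>.Fubini'[symmetric]) measurable
    also have "\<dots> = (\<integral>\<^sup>+x. \<integral>\<^sup>+y. \<integral>\<^sup>+z. ?k n (x - z) * ?k n (y - z) \<partial>lborel \<partial>\<mu> \<partial>\<mu>)"
      by (intro nn_integral_cong L\<mu>.Fubini'[symmetric]) measurable
    also have "\<dots> = (\<integral>\<^sup>+x. \<integral>\<^sup>+y. ennreal (normal_density 0 (sqrt 2 * \<sigma> n) (x - y)) \<partial>\<mu> \<partial>\<mu>)"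
      by (simp add: nn_integral_normal_density_convolution \<sigma>)
    finally have "(J n)\<^sup>2 \<le> ennreal P * ennreal B"
      by (rule order.trans) (intro mult_mono P energy, auto)
    then show "(J n)\<^sup>2 \<le> ennreal (P * B)" using P B by (simp add: ennreal_mult)
  qed (use P B in auto)
  moreover have "(\<integral>\<^sup>+x. ennreal (\<psi> x) \<partial>\<mu>) \<le> liminf J"
  proof -
    have "(\<integral>\<^sup>+x. ennreal (\<psi> x) \<partial>\<mu>) \<le> (\<integral>\<^sup>+x. liminf (\<lambda>n. \<integral>\<^sup>+z. ennreal (\<psi> z) * ?k n (x - z) \<partial>lborel) \<partial>\<mu>)"
      by (intro nn_integral_mono nn_integral_le_of_approx_identity cont nonneg \<sigma>)
    also have "\<dots> \<le> liminf J" unfolding J_def by (rule nn_integral_liminf) measurable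
    finally show ?thesis .
  qed
  ultimately show ?thesis
    using liminf_le_const order.trans by blast
qed

text \<open>Indicators of open sets are pointwise limits of continuous functions below them, here
  multiples of the distance to the complement cut off at 1.\<close>

lemma emeasure_open_le:
  assumes U: "open U" "emeasure lborel U \<le> ennreal P" "0 \<le> P"
  shows "emeasure \<mu> U \<le> ennreal (sqrt (P * B))"
proof -
  \<comment> \<open>\<open>infdist\<close> to the empty set is 0 by convention, so the approximation
    would fail for the whole line; its infinite Lebesgue measure excludes it.\<close>
  have ne: "- U \<noteq> {}"
  proof
    assume "- U = {}"
    then have "U = UNIV" by auto
    then show False using U(2) by (simp add: top_unique)
  qed
  define \<psi> where "\<psi> n x = min 1 (real n * infdist x (- U))" for n x
  have \<psi>01: "0 \<le> \<psi> n x" "\<psi> n x \<le> 1" for n x by (auto simp: \<psi>_def infdist_nonneg)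
  have \<psi>0: "\<psi> n x = 0" if "x \<notin> U" for n x using that by (simp add: \<psi>_def)
  have cont: "continuous_on UNIV (\<psi> n)" for n
    unfolding \<psi>_def by (intro continuous_intros)
  have [measurable]: "\<psi> n \<in> borel_measurable borel" "U \<in> sets borel" for n
    using cont U by (auto intro: borel_measurable_continuous_onI)
  have "emeasure \<mu> U = (\<integral>\<^sup>+x. indicator U x \<partial>\<mu>)" by simp
  also have "\<dots> \<le> (\<integral>\<^sup>+x. liminf (\<lambda>n. ennreal (\<psi> n x)) \<partial>\<mu>)"
  proof (intro nn_integral_mono)
    fix x
    show "indicator U x \<le> liminf (\<lambda>n. ennreal (\<psi> n x))"
    proof (cases "x \<in> U")
      case True
      then have "0 < infdist x (- U)"
        using in_closed_iff_infdist_zero[of "- U" x] ne U(1) infdist_nonneg[of x "- U"]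
        by (auto simp: closed_def less_le)
      moreover obtain k :: nat where "1 / infdist x (- U) \<le> real k" using real_arch_simple by blast
      ultimately have "1 \<le> real n * infdist x (- U)" if "n \<ge> k" for n
        using that by (simp add: divide_le_eq order.trans[OF _ mult_right_mono])
      then have "\<forall>\<^sub>F n in sequentially. ennreal (\<psi> n x) = 1"
        unfolding eventually_sequentially \<psi>_def by (intro exI[of _ k]) auto
      then have "(\<lambda>n. ennreal (\<psi> n x)) \<longlonglongrightarrow> 1" by (rule tendsto_eventually)
      then show ?thesis using True by (simp add: lim_imp_Liminf)
    qed simp
  qed
  also have "\<dots> \<le> liminf (\<lambda>n. \<integral>\<^sup>+x. ennreal (\<psi> n x) \<partial>\<mu>)"
    by (rule nn_integral_liminf) measurable
  also have "\<dots> \<le> ennreal (sqrt (P * B))"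
  proof -
    have "(\<integral>\<^sup>+x. ennreal (\<psi> n x) \<partial>\<mu>) \<le> ennreal (sqrt (P * B))" for n
    proof (rule nn_integral_continuous_le[OF cont \<psi>01(1) _ U(3)])
      have "(\<integral>\<^sup>+x. (ennreal (\<psi> n x))\<^sup>2 \<partial>lborel) \<le> (\<integral>\<^sup>+x. indicator U x \<partial>lborel)"
        using \<psi>01 \<psi>0 by (intro nn_integral_mono) (auto simp: indicator_def ennreal_power power_le_one)
      then show "(\<integral>\<^sup>+x. (ennreal (\<psi> n x))\<^sup>2 \<partial>lborel) \<le> ennreal P"
        using U(2) by simp
    qed
    then show ?thesis by (rule liminf_le_const)
  qed
  finally show ?thesis .
qed

lemma absolutely_continuous_lborel: "absolutely_continuous lborel \<mu>"
  unfolding absolutely_continuous_def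
proof
  fix N :: "real set" assume "N \<in> null_sets lborel"
  then have N: "N \<in> sets borel" "emeasure lborel N = 0" by auto
  have "emeasure \<mu> N \<le> ennreal e" if e: "0 < e" for e
  proof -
    \<comment> \<open>Chosen such that \<open>sqrt (d * B) \<le> e\<close>; the summand 1 guards
      against \<open>B = 0\<close>. An open neighbourhood of the null set of Lebesgue measure at
      most \<open>d\<close> then has \<open>\<mu>\<close>-measure at most \<open>e\<close>.\<close>
    define d where "d = e\<^sup>2 / (B + 1)"
    have d: "0 < d" "d * B \<le> e\<^sup>2" using e B by (auto simp: d_def divide_simps)
    obtain U where U: "open U" "N \<subseteq> U" "emeasure lborel (U - N) < d"
      using outer_regular_lborel[OF N(1) d(1)] by blast
    have [measurable]: "U \<in> sets borel" using U by auto
    have "emeasure lborel U \<le> emeasure lborel N + emeasure lborel (U - N)"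
      using U N by (subst plus_emeasure) (auto intro!: emeasure_mono)
    then have "emeasure lborel U \<le> ennreal d" using N U by auto
    then have "emeasure \<mu> U \<le> ennreal (sqrt (d * B))" using U d by (intro emeasure_open_le) auto
    moreover have "emeasure \<mu> N \<le> emeasure \<mu> U" using U by (intro emeasure_mono) auto
    moreover have "sqrt (d * B) \<le> e" using d e by (intro real_le_lsqrt) auto
    ultimately show ?thesis by (meson ennreal_leI order.trans)
  qed
  then have "emeasure \<mu> N = 0"
    by (metis bot.extremum_uniqueI bot_ennreal dual_order.refl ennreal_le_epsilon  add_0)
  then show "N \<in> null_sets \<mu>" using N by auto
qed

text \<open>Absolute continuity is what makes the step from continuous to measurable functions
  possible: a limit that holds Lebesgue almost everywhere now also holds \<open>\<mu>\<close>-almost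
  everywhere.\<close>

lemma nn_integral_bounded_le:
  assumes [measurable]: "h \<in> borel_measurable borel" and h: "\<And>x. 0 \<le> h x" "\<And>x. h x \<le> K"
    and supp: "\<And>x. \<bar>x\<bar> > R \<Longrightarrow> h x = 0"
  shows "(\<integral>\<^sup>+x. ennreal (h x) \<partial>\<mu>) \<le> ennreal (sqrt ((LINT x|lborel. (h x)\<^sup>2) * B))"
proof -
  have "h measurable_on UNIV"
  proof (rule lebesgue_measurable_imp_measurable_on_real)
    show "h \<in> borel_measurable lebesgue" by (rule measurable_completion) measurable
  qed simp
  then obtain N c where N: "negligible N" and c: "\<And>n. continuous_on UNIV (c n)"
    and lim: "\<And>x. x \<notin> N \<Longrightarrow> (\<lambda>n. c n x) \<longlonglongrightarrow> h x"
    unfolding measurable_on_def by auto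
  \<comment> \<open>Clipping to \<open>{0..K}\<close> and multiplying by a cutoff that is 1 on
    \<open>{-R..R}\<close> leaves the limit \<open>h\<close> unchanged and supplies an integrable
    majorant.\<close>
  define \<psi> where "\<psi> n x = max 0 (min K (c n x)) * max 0 (min 1 (R + 1 - \<bar>x\<bar>))" for n x
  have K: "0 \<le> K" using h[of 0] by linarith
  have cont: "continuous_on UNIV (\<psi> n)" for n
    unfolding \<psi>_def by (intro continuous_intros continuous_on_mult c)
  have [measurable]: "\<psi> n \<in> borel_measurable borel" for n
    using cont by (auto intro: borel_measurable_continuous_onI)
  have \<psi>0: "0 \<le> \<psi> n x" for n x by (simp add: \<psi>_def)
  have \<psi>le: "\<psi> n x \<le> K * indicator {-(R+1)..R+1} x" for n x
  proof -
    have "max 0 (min K (c n x)) \<le> K" "max 0 (min 1 (R + 1 - \<bar>x\<bar>)) \<le> indicator {-(R+1)..R+1} x"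
      using K by (auto simp: indicator_def)
    then show ?thesis unfolding \<psi>_def using K by (intro mult_mono) auto
  qed
  have lim\<psi>: "(\<lambda>n. \<psi> n x) \<longlonglongrightarrow> h x" if "x \<notin> N" for x
  proof -
    have "(\<lambda>n. \<psi> n x) \<longlonglongrightarrow> max 0 (min K (h x)) * max 0 (min 1 (R + 1 - \<bar>x\<bar>))"
      unfolding \<psi>_def by (intro tendsto_intros tendsto_max tendsto_min lim that)
    also have "max 0 (min K (h x)) * max 0 (min 1 (R + 1 - \<bar>x\<bar>)) = h x"
      using h[of x] supp[of x] by (cases "\<bar>x\<bar> > R") auto
    finally show ?thesis .
  qed
  have "AE x in lebesgue. x \<notin> N"
    using N by (metis AE_not_in negligible_iff_null_sets)
  then have AE_lborel: "AE x in lborel. (\<lambda>n. \<psi> n x) \<longlonglongrightarrow> h x"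
    using lim\<psi> by (auto simp: AE_completion_iff elim: AE_mp)
  then have AE_\<mu>: "AE x in \<mu>. (\<lambda>n. \<psi> n x) \<longlonglongrightarrow> h x"
    by (rule absolutely_continuous_AE[OF _ absolutely_continuous_lborel, rotated]) simp
  define P where "P n = (LINT x|lborel. (\<psi> n x)\<^sup>2)" for n
  have dom: "integrable lborel (\<lambda>x. K\<^sup>2 * indicator {-(R+1)..R+1} x :: real)"
    by (intro integrable_mult_right) (auto simp: emeasure_lborel_Icc_eq)
  have sq_le: "(\<psi> n x)\<^sup>2 \<le> K\<^sup>2 * indicator {-(R+1)..R+1} x" for n x
    using power_mono[OF \<psi>le \<psi>0, of n x 2] by (auto simp: indicator_def power_mult_distrib)
  have int: "integrable lborel (\<lambda>x. (\<psi> n x)\<^sup>2)" for n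
    by (rule Bochner_Integration.integrable_bound[OF dom]) (use sq_le in \<open>auto intro!: AE_I2 order.trans[OF _ abs_ge_self]\<close>)
  have "P \<longlonglongrightarrow> (LINT x|lborel. (h x)\<^sup>2)"
    unfolding P_def
  proof (rule integral_dominated_convergence[OF _ _ dom])
    show "AE x in lborel. (\<lambda>n. (\<psi> n x)\<^sup>2) \<longlonglongrightarrow> (h x)\<^sup>2"
      using AE_lborel by eventually_elim (rule tendsto_power)
  qed (use sq_le in auto)
  then have lim_P: "(\<lambda>n. ennreal (sqrt (P n * B))) \<longlonglongrightarrow> ennreal (sqrt ((LINT x|lborel. (h x)\<^sup>2) * B))"
    by (intro tendsto_intros)
  have "(\<integral>\<^sup>+x. ennreal (h x) \<partial>\<mu>) = (\<integral>\<^sup>+x. liminf (\<lambda>n. ennreal (\<psi> n x)) \<partial>\<mu>)"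
    by (rule nn_integral_cong_AE, rule AE_mp[OF AE_\<mu>], rule AE_I2)
       (auto intro!: lim_imp_Liminf[symmetric] tendsto_ennrealI)
  also have "\<dots> \<le> liminf (\<lambda>n. \<integral>\<^sup>+x. ennreal (\<psi> n x) \<partial>\<mu>)"
    by (rule nn_integral_liminf) measurable
  also have "\<dots> \<le> liminf (\<lambda>n. ennreal (sqrt (P n * B)))"
  proof (intro Liminf_mono always_eventually allI nn_integral_continuous_le cont \<psi>0)
    fix n
    show "(\<integral>\<^sup>+x. (ennreal (\<psi> n x))\<^sup>2 \<partial>lborel) \<le> ennreal (P n)"
      unfolding P_def using int[of n] by (simp add: ennreal_power \<psi>0 nn_integral_eq_integral)
  qed (simp add: P_def)
  also have "\<dots> = ennreal (sqrt ((LINT x|lborel. (h x)\<^sup>2) * B))"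
    using lim_P by (simp add: lim_imp_Liminf)
  finally show ?thesis .
qed

text \<open>The density is tested against its own truncations. With \<open>S\<close> the integral of
  the squared truncation, duality gives \<open>S \<le> sqrt (S * B)\<close>; the truncation makes
  \<open>S\<close> finite, so that \<open>S \<le> B\<close> follows by division.\<close>

lemma RN_deriv_L2: "(\<integral>\<^sup>+x. (RN_deriv lborel \<mu> x)\<^sup>2 \<partial>lborel) \<le> ennreal B"
proof -
  define g where "g = RN_deriv lborel \<mu>"
  have [measurable]: "g \<in> borel_measurable borel" unfolding g_def by measurable
  have g: "density lborel g = \<mu>"
    unfolding g_def by (rule sigma_finite_measure.density_RN_deriv[OF sigma_finite_lborel absolutely_continuous_lborel]) simp
  define h where "h n x = enn2real (min (g x) (of_nat n)) * indicator {-real n..real n} x" for n x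
  have [measurable]: "h n \<in> borel_measurable borel" for n unfolding h_def by measurable
  have h_nonneg: "0 \<le> h n x" for n x by (simp add: h_def)
  have h_le: "h n x \<le> real n * indicator {-real n..real n} x" for n x
    unfolding h_def by (intro mult_right_mono enn2real_leI) (auto simp: ennreal_of_nat_eq_real_of_nat)
  have h_eq: "ennreal (h n x) = min (g x) (of_nat n) * indicator {-real n..real n} x" for n x
    unfolding h_def by (auto simp: indicator_def ennreal_enn2real_if min_def top_unique ennreal_of_nat_eq_real_of_nat)
  have sq: "(\<integral>\<^sup>+x. (ennreal (h n x))\<^sup>2 \<partial>lborel) \<le> ennreal B" for n
  proof -
    define S where "S = (LINT x|lborel. (h n x)\<^sup>2)"
    have int: "integrable lborel (\<lambda>x. (h n x)\<^sup>2)"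
    proof (rule Bochner_Integration.integrable_bound)
      show "integrable lborel (\<lambda>x. (real n)\<^sup>2 * indicator {-real n..real n} x :: real)"
        by (intro integrable_mult_right) (auto simp: emeasure_lborel_Icc_eq)
      show "AE x in lborel. norm ((h n x)\<^sup>2) \<le> norm ((real n)\<^sup>2 * indicator {-real n..real n} x :: real)"
      proof (intro AE_I2)
        fix x
        show "norm ((h n x)\<^sup>2) \<le> norm ((real n)\<^sup>2 * indicator {-real n..real n} x :: real)"
          using power_mono[OF h_le h_nonneg, of n x 2] by (cases "x \<in> {-real n..real n}") auto
      qed
    qed measurable
    have S: "(\<integral>\<^sup>+x. (ennreal (h n x))\<^sup>2 \<partial>lborel) = ennreal S"
      unfolding S_def using int by (simp add: ennreal_power h_nonneg nn_integral_eq_integral)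
    have S0: "0 \<le> S" by (simp add: S_def)
    have "(\<integral>\<^sup>+x. (ennreal (h n x))\<^sup>2 \<partial>lborel) \<le> (\<integral>\<^sup>+x. g x * ennreal (h n x) \<partial>lborel)"
      unfolding power2_eq_square h_eq
      by (intro nn_integral_mono mult_right_mono) (auto simp: indicator_def)
    also have "\<dots> = (\<integral>\<^sup>+x. ennreal (h n x) \<partial>\<mu>)"
      unfolding g[symmetric] by (rule nn_integral_density[symmetric]) measurable
    also have "\<dots> \<le> ennreal (sqrt (S * B))"
      unfolding S_def
    proof (rule nn_integral_bounded_le[where K = "real n" and R = "real n"])
      show "h n x \<le> real n" for x using h_le[of n x] by (cases "x \<in> {-real n..real n}") auto
      show "h n x = 0" if "real n < \<bar>x\<bar>" for x using that by (auto simp: h_def indicator_def)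
    qed (auto simp: h_nonneg)
    finally have "S \<le> sqrt (S * B)" using S0 B by (simp add: S)
    then have "S\<^sup>2 \<le> S * B" using S0 B by (metis mult_nonneg_nonneg power_mono real_sqrt_pow2)
    then have "S \<le> B" using S0 B by (cases "S = 0") (auto simp: power2_eq_square)
    then show ?thesis using S by (simp add: ennreal_leI)
  qed
  \<comment> \<open>Finiteness of \<open>\<mu>\<close> excludes infinite values of \<open>g\<close>
    almost everywhere; at all other points the truncations eventually equal
    \<open>g x\<close>.\<close>
  have "(\<integral>\<^sup>+x. g x \<partial>lborel) = emeasure \<mu> UNIV"
    by (simp add: g[symmetric] emeasure_density)
  then have "AE x in lborel. g x \<noteq> \<infinity>"
    using \<mu>.emeasure_finite[of UNIV] by (intro nn_integral_PInf_AE) auto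
  then have "(\<integral>\<^sup>+x. (g x)\<^sup>2 \<partial>lborel) = (\<integral>\<^sup>+x. liminf (\<lambda>n. (ennreal (h n x))\<^sup>2) \<partial>lborel)"
  proof (intro nn_integral_cong_AE, elim AE_mp, intro AE_I2 impI lim_imp_Liminf[symmetric] tendsto_eventually)
    fix x assume "g x \<noteq> \<infinity>"
    then obtain r where r: "0 \<le> r" "g x = ennreal r" by (cases "g x") auto
    obtain k :: nat where "max r \<bar>x\<bar> \<le> real k" using real_arch_simple by blast
    then have "ennreal (h n x) = g x" if "n \<ge> k" for n
      using that r unfolding h_eq by (auto simp: indicator_def ennreal_of_nat_eq_real_of_nat min_def)
    then show "\<forall>\<^sub>F n in sequentially. (ennreal (h n x))\<^sup>2 = (g x)\<^sup>2"
      by (intro eventually_sequentiallyI[of k]) auto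
  qed simp
  also have "\<dots> \<le> liminf (\<lambda>n. \<integral>\<^sup>+x. (ennreal (h n x))\<^sup>2 \<partial>lborel)"
    by (rule nn_integral_liminf) measurable
  also have "\<dots> \<le> ennreal B"
    by (rule liminf_le_const[OF sq])
  finally show ?thesis by (simp add: g_def)
qed

end

section \<open>Increments of the fractional kernels\<close>

lemma schwartz_higher_deriv_linear:
  assumes "\<phi> \<in> schwartz" "\<psi> \<in> schwartz"
  shows "(deriv ^^ n) (\<lambda>x. r * \<phi> x + q * \<psi> x) = (\<lambda>x. r * (deriv ^^ n) \<phi> x + q * (deriv ^^ n) \<psi> x)"
proof (induction n)
  case (Suc n)
  have "((\<lambda>x. r * (deriv ^^ n) \<phi> x + q * (deriv ^^ n) \<psi> x) has_field_derivative
      (r * deriv ((deriv ^^ n) \<phi>) x + q * deriv ((deriv ^^ n) \<psi>) x)) (at x)" for x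
    using assms unfolding schwartz_def
    by (intro derivative_intros DERIV_cmult) (auto simp: DERIV_deriv_iff_real_differentiable)
  then show ?case by (auto simp: Suc.IH intro: DERIV_imp_deriv)
qed simp

lemma schwartz_linear:
  assumes "\<phi> \<in> schwartz" "\<psi> \<in> schwartz"
  shows "(\<lambda>x. r * \<phi> x + q * \<psi> x) \<in> schwartz"
  unfolding schwartz_def mem_Collect_eq schwartz_higher_deriv_linear[OF assms]
proof (intro conjI allI)
  fix n x
  show "(\<lambda>x. r * (deriv ^^ n) \<phi> x + q * (deriv ^^ n) \<psi> x) differentiable at x"
    using assms unfolding schwartz_def by (intro derivative_intros) auto
next
  fix k n
  obtain A where A: "\<And>x. \<bar>x ^ k * (deriv ^^ n) \<phi> x\<bar> \<le> A"
    using assms(1) unfolding schwartz_def bdd_above_def by blast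
  obtain B where B: "\<And>x. \<bar>x ^ k * (deriv ^^ n) \<psi> x\<bar> \<le> B"
    using assms(2) unfolding schwartz_def bdd_above_def by blast
  show "bdd_above (range (\<lambda>x. \<bar>x ^ k * (r * (deriv ^^ n) \<phi> x + q * (deriv ^^ n) \<psi> x)\<bar>))"
  proof (rule bdd_aboveI2)
    fix x
    have "\<bar>x ^ k * (r * (deriv ^^ n) \<phi> x + q * (deriv ^^ n) \<psi> x)\<bar>
        = \<bar>r * (x ^ k * (deriv ^^ n) \<phi> x) + q * (x ^ k * (deriv ^^ n) \<psi> x)\<bar>"
      by (simp add: algebra_simps)
    also have "\<dots> \<le> \<bar>r\<bar> * \<bar>x ^ k * (deriv ^^ n) \<phi> x\<bar> + \<bar>q\<bar> * \<bar>x ^ k * (deriv ^^ n) \<psi> x\<bar>"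
      by (rule order.trans[OF abs_triangle_ineq]) (simp add: abs_mult)
    also have "\<dots> \<le> \<bar>r\<bar> * A + \<bar>q\<bar> * B"
      by (intro add_mono mult_left_mono A B) auto
    finally show "\<bar>x ^ k * (r * (deriv ^^ n) \<phi> x + q * (deriv ^^ n) \<psi> x)\<bar> \<le> \<bar>r\<bar> * A + \<bar>q\<bar> * B" .
  qed
qed

lemma schwartz_borel_measurable: 
  assumes "\<phi> \<in> schwartz"
  shows "\<phi> \<in> borel_measurable borel"
proof (rule borel_measurable_continuous_onI, rule differentiable_imp_continuous_on)
  have "(deriv ^^ 0) \<phi> differentiable (at x)" for x using assms unfolding schwartz_def by blast
  then show "\<phi> differentiable_on UNIV" by (simp add: differentiable_on_def)
qed

lemma schwartz_square_integrable:
  assumes "\<phi> \<in> schwartz"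
  shows "integrable lborel (\<lambda>x. \<phi> x * \<phi> x)"
proof -
  have "\<forall>k n. bdd_above (range (\<lambda>x. \<bar>x ^ k * (deriv ^^ n) \<phi> x\<bar>))"
    using assms by (simp add: schwartz_def)
  from this[rule_format, of _ 0] have bdd: "bdd_above (range (\<lambda>x. \<bar>x ^ k * \<phi> x\<bar>))" for k
    by simp
  obtain A where A: "\<And>x. \<bar>\<phi> x\<bar> \<le> A" using bdd[of 0] unfolding bdd_above_def by auto
  obtain B where B: "\<And>x. \<bar>x * \<phi> x\<bar> \<le> B" using bdd[of 1] unfolding bdd_above_def by auto
  have [measurable]: "\<phi> \<in> borel_measurable borel" by (rule schwartz_borel_measurable[OF assms])
  have le: "\<bar>\<phi> x * \<phi> x\<bar> \<le> (A\<^sup>2 + B\<^sup>2) * inverse (1 + x\<^sup>2)" for x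
  proof -
    have "\<phi> x * \<phi> x * (1 + x\<^sup>2) = \<bar>\<phi> x\<bar>\<^sup>2 + \<bar>x * \<phi> x\<bar>\<^sup>2"
      by (simp add: power2_eq_square algebra_simps)
    also have "\<dots> \<le> A\<^sup>2 + B\<^sup>2" by (intro add_mono power_mono A B) auto
    finally show ?thesis by (simp add: divide_inverse[symmetric] pos_le_divide_eq add_pos_nonneg)
  qed
  have int: "integrable lborel (\<lambda>x::real. (A\<^sup>2 + B\<^sup>2) * inverse (1 + x\<^sup>2))"
    by (intro integrable_mult_right integrable_inverse_1_plus_square_lborel)
  show ?thesis
    by (rule Bochner_Integration.integrable_bound[OF int]) (use le in \<open>auto intro!: AE_I2 order.trans[OF _ abs_ge_self]\<close>)
qed

section \<open>Fractional operators applied to indicators\<close>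

lemma nn_integral_powr_from_0:
  assumes "e > -1" "0 \<le> c"
  shows "(\<integral>\<^sup>+x. ennreal (x powr e) * indicator {0..c} x \<partial>lborel) = ennreal (c powr (e + 1) / (e + 1))"
  using has_integral_powr_from_0[OF assms] by (rule nn_integral_has_integral_lebesgue'[rotated]) auto

text \<open>Covers both fractional operators: \<open>e = \<sigma> - 1\<close> for the integral and
  \<open>e = - \<sigma>\<close> for the function under the derivative.\<close>

lemma LINT_powr_shifted:
  fixes e x t :: real
  assumes "e > -1" "0 \<le> x" "x \<le> t"
  shows "(LINT u:{x<..}|lborel. indicator {0..<t} u * (u - x) powr e) = (t - x) powr (e + 1) / (e + 1)"
proof -
  have "(LINT u:{x<..}|lborel. indicator {0..<t} u * (u - x) powr e)
      = (LINT u|lborel. (u - x) powr e * indicator {x<..<t} u)"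
  proof -
    have "indicator {x<..} u * indicator {0..<t} u = (indicator {x<..<t} u :: real)" for u
      using assms(2) by (auto split: split_indicator)
    then show ?thesis
      unfolding set_lebesgue_integral_def by (simp add: mult_ac flip: mult.assoc)
  qed
  also have "\<dots> = (LINT v|lborel. v powr e * indicator {0<..<t - x} v)"
    by (subst lborel_integral_real_affine[of 1 _ x]) (auto simp: indicator_def intro!: Bochner_Integration.integral_cong)
  also have "\<dots> = enn2real (\<integral>\<^sup>+v. ennreal (v powr e * indicator {0<..<t - x} v) \<partial>lborel)"
    by (rule integral_eq_nn_integral) auto
  also have "(\<integral>\<^sup>+v. ennreal (v powr e * indicator {0<..<t - x} v) \<partial>lborel)
      = (\<integral>\<^sup>+v. ennreal (v powr e) * indicator {0..t - x} v \<partial>lborel)"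
  proof (rule nn_integral_cong_AE)
    have "AE v in lborel. v \<noteq> 0 \<and> v \<noteq> t - x" by (intro AE_conjI AE_lborel_singleton)
    then show "AE v in lborel. ennreal (v powr e * indicator {0<..<t - x} v) = ennreal (v powr e) * indicator {0..t - x} v"
      by eventually_elim (auto simp: indicator_def)
  qed
  finally show ?thesis using assms by (simp add: nn_integral_powr_from_0 divide_nonneg_pos)
qed

lemma LINT_powr_shifted_0:
  fixes e x t :: real
  assumes "t \<le> x"
  shows "(LINT u:{x<..}|lborel. indicator {0..<t} u * (u - x) powr e) = (0::real)"
proof -
  have "(LINT u:{x<..}|lborel. indicator {0..<t} u * (u - x) powr e) = (LINT u::real|lborel. (0::real))"
    unfolding set_lebesgue_integral_def using assms
    by (intro Bochner_Integration.integral_cong) (auto simp: indicator_def)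
  then show ?thesis by simp
qed

text \<open>The Bochner integral of a nonnegative function is nonnegative whether or not it
  converges, so the summand \<open>1 / (2 * H)\<close> settles the sign.\<close>

lemma hurst_const_pos:
  assumes "0 < H"
  shows "0 < hurst_const H"
proof -
  have "0 \<le> (LINT s:{0<..}|lborel. ((1 + s) powr (H - 1 / 2) - s powr (H - 1 / 2))\<^sup>2)"
    unfolding set_lebesgue_integral_def by (intro Bochner_Integration.integral_nonneg) auto
  then have "0 < (LINT s:{0<..}|lborel. ((1 + s) powr (H - 1 / 2) - s powr (H - 1 / 2))\<^sup>2) + 1 / (2 * H)"
    using assms by (intro add_nonneg_pos) auto
  then show ?thesis
    unfolding hurst_const_def using assms by (intro mult_pos_pos Gamma_real_pos) auto
qed

text \<open>To the right of 0 all three branches of \<open>M_minus\<close> reduce to one truncated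
  power. The endpoint \<open>x = t\<close> is left out: the derivative in the branch
  \<open>H < 1/2\<close> needs a neighbourhood on which a single formula holds.\<close>

lemma M_minus_indicator:
  assumes H: "0 < H" "H < 1"
  obtains \<kappa> where "0 < \<kappa>"
    "\<And>t x. 0 < x \<Longrightarrow> x < t \<Longrightarrow> M_minus H (indicator {0..<t}) x = \<kappa> * (t - x) powr (H - 1/2)"
    "\<And>t x. t < x \<Longrightarrow> M_minus H (indicator {0..<t}) x = 0"
proof -
  consider "H < 1/2" | "H = 1/2" | "H > 1/2" by linarith
  then show ?thesis
  proof cases
    case 1
    \<comment> \<open>With fractional order \<open>1/2 - H\<close> the normalisation
      \<open>Gamma (1 - \<sigma>)\<close> is \<open>Gamma (H + 1/2)\<close>; the factor
      \<open>1 / (H + 1/2)\<close> from the integral cancels under differentiation.\<close>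
    define \<kappa> where "\<kappa> = hurst_const H / Gamma (H + 1/2)"
    let ?f = "\<lambda>t y. LINT u:{y<..}|lborel. indicator {0..<t} u * (u - y) powr (- (1/2 - H)) :: real"
    have M: "M_minus H (indicator {0..<t}) x = - \<kappa> * deriv (?f t) x" for t x
      using 1 by (simp add: M_minus_def frac_deriv_minus_def \<kappa>_def field_simps)
    show ?thesis
    proof (rule that[of \<kappa>])
      show "0 < \<kappa>" using hurst_const_pos[OF H(1)] Gamma_real_pos[of "H + 1/2"] H by (auto simp: \<kappa>_def)
    next
      fix t x :: real assume x: "0 < x" "x < t"
      have "eventually (\<lambda>y. y \<in> {0<..<t}) (nhds x)"
        using x by (intro eventually_nhds_in_open) auto
      then have "eventually (\<lambda>y. ?f t y = (t - y) powr (H + 1/2) / (H + 1/2)) (nhds x)"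
        by eventually_elim (subst LINT_powr_shifted, use H in \<open>auto simp: algebra_simps\<close>)
      then have "deriv (?f t) x = deriv (\<lambda>y. (t - y) powr (H + 1/2) / (H + 1/2)) x"
        by (rule deriv_cong_ev) simp
      also have "\<dots> = - ((t - x) powr (H - 1/2))"
      proof (rule DERIV_imp_deriv)
        have "((\<lambda>y. (t - y) powr (H + 1/2) / (H + 1/2)) has_real_derivative
            ((H + 1/2) * (t - x) powr (H + 1/2 - 1) * (-1)) / (H + 1/2)) (at x)"
          using x H by (auto intro!: derivative_eq_intros)
        then show "((\<lambda>y. (t - y) powr (H + 1/2) / (H + 1/2)) has_real_derivative - ((t - x) powr (H - 1/2))) (at x)"
          using H by (simp add: add_pos_pos less_imp_neq[symmetric])
      qed
      finally show "M_minus H (indicator {0..<t}) x = \<kappa> * (t - x) powr (H - 1/2)"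
        by (simp add: M)
    next
      fix t x :: real assume x: "t < x"
      have "eventually (\<lambda>y. y \<in> {t<..}) (nhds x)"
        using x by (intro eventually_nhds_in_open) auto
      then have "eventually (\<lambda>y. ?f t y = 0) (nhds x)"
        by eventually_elim (rule LINT_powr_shifted_0, auto)
      then have "deriv (?f t) x = deriv (\<lambda>y. 0) x" by (rule deriv_cong_ev) simp
      then show "M_minus H (indicator {0..<t}) x = 0" by (simp add: M)
    qed
  next
    case 2
    show ?thesis by (intro that[of 1]) (simp_all add: M_minus_def 2)
  next
    case 3
    \<comment> \<open>By the recursion for \<open>Gamma\<close> this is the same constant as for
      \<open>H < 1/2\<close>.\<close>
    define \<kappa> where "\<kappa> = hurst_const H / (Gamma (H - 1/2) * (H - 1/2))"
    show ?thesis
    proof (rule that[of \<kappa>])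
      show "0 < \<kappa>" using hurst_const_pos[OF H(1)] Gamma_real_pos[of "H - 1/2"] 3 by (auto simp: \<kappa>_def)
    next
      fix t x :: real assume x: "0 < x" "x < t"
      have "(LINT u:{x<..}|lborel. indicator {0..<t} u * (u - x) powr (H - 1/2 - 1)) = (t - x) powr (H - 1/2) / (H - 1/2)"
        by (subst LINT_powr_shifted) (use x 3 in auto)
      then show "M_minus H (indicator {0..<t}) x = \<kappa> * (t - x) powr (H - 1/2)"
        using 3 by (simp add: M_minus_def frac_integral_minus_def \<kappa>_def)
    next
      fix t x :: real assume x: "t < x"
      then show "M_minus H (indicator {0..<t}) x = 0"
        using 3 LINT_powr_shifted_0[of t x "H - 1/2 - 1"] by (simp add: M_minus_def frac_integral_minus_def)
    qed
  qed
qed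

text \<open>A lower bound of the right order suffices: on \<open>{s<..<t}\<close> the second kernel vanishes, and on
  the first half of that interval the first one is bounded below whatever the sign of \<open>H - 1/2\<close>.\<close>

lemma M_minus_increment_lower_bound:
  assumes H: "0 < H" "H < 1"
  obtains c0 where "0 < c0"
    "\<And>s t \<phi> \<psi>. 0 \<le> s \<Longrightarrow> s < t \<Longrightarrow> \<forall>n. \<phi> n \<in> schwartz \<Longrightarrow> \<forall>n. \<psi> n \<in> schwartz \<Longrightarrow>
      (\<lambda>n. \<integral>\<^sup>+ x. ennreal ((\<phi> n x - M_minus H (indicator {0..<t}) x)\<^sup>2) \<partial>lborel) \<longlonglongrightarrow> 0 \<Longrightarrow>
      (\<lambda>n. \<integral>\<^sup>+ x. ennreal ((\<psi> n x - M_minus H (indicator {0..<s}) x)\<^sup>2) \<partial>lborel) \<longlonglongrightarrow> 0 \<Longrightarrow>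
      \<forall>\<^sub>F n in sequentially. c0 * (t - s) powr (2 * H) \<le> (LINT x|lborel. (\<phi> n x - \<psi> n x)\<^sup>2)"
proof -
  obtain \<kappa> where \<kappa>: "0 < \<kappa>"
    "\<And>t x. 0 < x \<Longrightarrow> x < t \<Longrightarrow> M_minus H (indicator {0..<t}) x = \<kappa> * (t - x) powr (H - 1/2)"
    "\<And>t x. t < x \<Longrightarrow> M_minus H (indicator {0..<t}) x = 0"
    using M_minus_indicator[OF H] by blast
  show ?thesis
  \<comment> \<open>With \<open>D\<close> a lower bound for the squared norm of the first kernel on
    \<open>J\<close> and both approximation errors below \<open>D / 12\<close>, the estimate
    \<open>D \<le> 3 * (D / 12 + R + D / 12)\<close> gives \<open>R \<ge> D / 6\<close>, where
    \<open>R\<close> is the squared norm of the increment. As \<open>D\<close> carries the factor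
    \<open>1 / 4\<close>, the constant is \<open>1 / 24\<close>.\<close>
  proof (rule that[of "\<kappa>\<^sup>2 / 24"])
    show "0 < \<kappa>\<^sup>2 / 24" using \<kappa> by simp
    fix s t :: real and \<phi> \<psi> :: "nat \<Rightarrow> real \<Rightarrow> real"
    assume st: "0 \<le> s" "s < t" and \<phi>: "\<forall>n. \<phi> n \<in> schwartz" and \<psi>: "\<forall>n. \<psi> n \<in> schwartz"
      and lim\<phi>: "(\<lambda>n. \<integral>\<^sup>+ x. ennreal ((\<phi> n x - M_minus H (indicator {0..<t}) x)\<^sup>2) \<partial>lborel) \<longlonglongrightarrow> 0"
      and lim\<psi>: "(\<lambda>n. \<integral>\<^sup>+ x. ennreal ((\<psi> n x - M_minus H (indicator {0..<s}) x)\<^sup>2) \<partial>lborel) \<longlonglongrightarrow> 0"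
    have [measurable]: "\<phi> n \<in> borel_measurable borel" "\<psi> n \<in> borel_measurable borel" for n
      using \<phi> \<psi> by (auto intro: schwartz_borel_measurable)
    define J where "J = {s<..<(s + t)/2}"
    define f where "f x = \<kappa> * (t - x) powr (H - 1/2)" for x
    \<comment> \<open>The factor \<open>1 / 2\<close> is for a nonnegative exponent: the power is
      then smallest at \<open>(t - s) / 2\<close>, and halving the base costs at most a factor 2
      because \<open>2 * H - 1 \<le> 1\<close>.\<close>
    define m where "m = \<kappa>\<^sup>2 * (t - s) powr (2 * H - 1) / 2"
    define D where "D = \<kappa>\<^sup>2 * (t - s) powr (2 * H) / 4"
    have D: "0 < D" using \<kappa> st by (simp add: D_def)
    have [measurable]: "f \<in> borel_measurable borel" unfolding f_def by measurable
    have mD: "ennreal m * emeasure lborel J = ennreal D"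
    proof -
      have "emeasure lborel J = ennreal ((t - s) / 2)"
        unfolding J_def using st by (simp add: field_simps)
      moreover have "(t - s) powr (2 * H) = (t - s) powr (2 * H - 1) * (t - s) powr 1"
        unfolding powr_add[symmetric] by simp
      ultimately show ?thesis
        using st by (simp add: m_def D_def ennreal_mult[symmetric])
    qed
    have f_ge: "m \<le> (f x)\<^sup>2" if "x \<in> J" for x
    proof -
      have x: "(t - s) / 2 \<le> t - x" "t - x \<le> t - s" "0 < t - x" using that st by (auto simp: J_def field_simps)
      have "(t - s) powr (2 * H - 1) / 2 \<le> (t - x) powr (2 * H - 1)"
      proof (cases "2 * H - 1 \<ge> 0")
        case True
        have "(t - s) powr (2 * H - 1) / 2 \<le> (t - s) powr (2 * H - 1) / 2 powr (2 * H - 1)"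
        proof (intro divide_left_mono)
          have "2 powr (2 * H - 1) \<le> (2::real) powr 1" using H by (intro powr_mono) auto
          then show "2 powr (2 * H - 1) \<le> (2::real)" by simp
        qed auto
        also have "\<dots> = ((t - s) / 2) powr (2 * H - 1)" using st by (simp add: powr_divide)
        also have "\<dots> \<le> (t - x) powr (2 * H - 1)" using x True st by (intro powr_mono2) auto
        finally show ?thesis .
      next
        case False
        have "(t - s) powr (2 * H - 1) / 2 \<le> (t - s) powr (2 * H - 1)" by simp
        also have "\<dots> \<le> (t - x) powr (2 * H - 1)" using x False st by (intro powr_mono2') auto
        finally show ?thesis .
      qed
      then have "\<kappa>\<^sup>2 * ((t - s) powr (2 * H - 1) / 2) \<le> \<kappa>\<^sup>2 * (t - x) powr (2 * H - 1)"
        by (intro mult_left_mono) auto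
      also have "(t - x) powr (2 * H - 1) = (t - x) powr (H - 1/2) * (t - x) powr (H - 1/2)"
        unfolding powr_add[symmetric] by simp
      finally show ?thesis by (simp add: m_def f_def power2_eq_square algebra_simps)
    qed
    have e1: "(\<integral>\<^sup>+ x. ennreal ((\<phi> n x - f x)\<^sup>2) * indicator J x \<partial>lborel)
        \<le> (\<integral>\<^sup>+ x. ennreal ((\<phi> n x - M_minus H (indicator {0..<t}) x)\<^sup>2) \<partial>lborel)" for n
      using st by (intro nn_integral_mono) (auto simp: indicator_def J_def f_def \<kappa>(2) split: if_splits)
    have e2: "(\<integral>\<^sup>+ x. ennreal ((\<psi> n x)\<^sup>2) * indicator J x \<partial>lborel)
        \<le> (\<integral>\<^sup>+ x. ennreal ((\<psi> n x - M_minus H (indicator {0..<s}) x)\<^sup>2) \<partial>lborel)" for n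
      by (intro nn_integral_mono) (auto simp: indicator_def J_def \<kappa>(3))
    have int: "integrable lborel (\<lambda>x. (\<phi> n x - \<psi> n x)\<^sup>2)" for n
      using schwartz_square_integrable[OF schwartz_linear[of "\<phi> n" "\<psi> n" 1 "-1"]] \<phi> \<psi>
      by (simp add: power2_eq_square)
    have D_le: "ennreal D \<le> 3 * ((\<integral>\<^sup>+ x. ennreal ((\<phi> n x - f x)\<^sup>2) * indicator J x \<partial>lborel)
        + ennreal (LINT x|lborel. (\<phi> n x - \<psi> n x)\<^sup>2) + (\<integral>\<^sup>+ x. ennreal ((\<psi> n x)\<^sup>2) * indicator J x \<partial>lborel))" for n
    proof -
      have "ennreal D = (\<integral>\<^sup>+ x. ennreal m * indicator J x \<partial>lborel)"
        unfolding mD[symmetric] by (rule nn_integral_cmult_indicator[symmetric]) (simp add: J_def)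
      also have "\<dots> \<le> (\<integral>\<^sup>+ x. 3 * (ennreal ((\<phi> n x - f x)\<^sup>2) * indicator J x
          + ennreal ((\<phi> n x - \<psi> n x)\<^sup>2) + ennreal ((\<psi> n x)\<^sup>2) * indicator J x) \<partial>lborel)"
      proof (intro nn_integral_mono)
        fix x
        show "ennreal m * indicator J x \<le> 3 * (ennreal ((\<phi> n x - f x)\<^sup>2) * indicator J x
          + ennreal ((\<phi> n x - \<psi> n x)\<^sup>2) + ennreal ((\<psi> n x)\<^sup>2) * indicator J x)"
        proof (cases "x \<in> J")
          case True
          \<comment> \<open>Applied to
            \<open>f = (\<phi> n - \<psi> n) - (\<phi> n - f) + \<psi> n\<close>, where the last two
            terms are the approximation errors, since the second kernel vanishes on
            \<open>J\<close>.\<close>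
          have tri: "(u - v + w)\<^sup>2 \<le> 3 * (v\<^sup>2 + u\<^sup>2 + w\<^sup>2)" for u v w :: real
          proof -
            have "3 * (v\<^sup>2 + u\<^sup>2 + w\<^sup>2) - (u - v + w)\<^sup>2 = (u + v)\<^sup>2 + (u - w)\<^sup>2 + (v + w)\<^sup>2"
              by (simp add: power2_eq_square algebra_simps)
            moreover have "0 \<le> (u + v)\<^sup>2 + (u - w)\<^sup>2 + (v + w)\<^sup>2" by simp
            ultimately show ?thesis by linarith
          qed
          have "m \<le> 3 * ((\<phi> n x - f x)\<^sup>2 + (\<phi> n x - \<psi> n x)\<^sup>2 + (\<psi> n x)\<^sup>2)"
            using f_ge[OF True] tri[of "\<phi> n x - \<psi> n x" "\<phi> n x - f x" "\<psi> n x"] by simp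
          then have "ennreal m \<le> ennreal (3 * ((\<phi> n x - f x)\<^sup>2 + (\<phi> n x - \<psi> n x)\<^sup>2 + (\<psi> n x)\<^sup>2))"
            by (rule ennreal_leI)
          also have "\<dots> = 3 * (ennreal ((\<phi> n x - f x)\<^sup>2) + ennreal ((\<phi> n x - \<psi> n x)\<^sup>2) + ennreal ((\<psi> n x)\<^sup>2))"
            by (subst ennreal_mult) (auto simp: ennreal_plus[symmetric] simp del: ennreal_plus)
          finally show ?thesis using True by simp
        qed simp
      qed
      also have "\<dots> = 3 * ((\<integral>\<^sup>+ x. ennreal ((\<phi> n x - f x)\<^sup>2) * indicator J x \<partial>lborel)
          + (\<integral>\<^sup>+ x. ennreal ((\<phi> n x - \<psi> n x)\<^sup>2) \<partial>lborel) + (\<integral>\<^sup>+ x. ennreal ((\<psi> n x)\<^sup>2) * indicator J x \<partial>lborel))"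
        by (simp add: nn_integral_cmult nn_integral_add J_def)
      also have "(\<integral>\<^sup>+ x. ennreal ((\<phi> n x - \<psi> n x)\<^sup>2) \<partial>lborel) = ennreal (LINT x|lborel. (\<phi> n x - \<psi> n x)\<^sup>2)"
        using int by (intro nn_integral_eq_integral) auto
      finally show ?thesis .
    qed
    have small: "0 < ennreal (D / 12)" using D by simp
    show "\<forall>\<^sub>F n in sequentially. \<kappa>\<^sup>2 / 24 * (t - s) powr (2 * H) \<le> (LINT x|lborel. (\<phi> n x - \<psi> n x)\<^sup>2)"
      using order_tendstoD(2)[OF lim\<phi> small] order_tendstoD(2)[OF lim\<psi> small]
    proof eventually_elim
      case (elim n)
      let ?R = "LINT x|lborel. (\<phi> n x - \<psi> n x)\<^sup>2"
      have "ennreal D \<le> 3 * (ennreal (D / 12) + ennreal ?R + ennreal (D / 12))"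
        by (rule order.trans[OF D_le[of n]])
           (intro mult_left_mono add_mono order.trans[OF e1] order.trans[OF e2] less_imp_le elim order.refl, auto)
      also have "\<dots> = ennreal (3 * (D / 12 + ?R + D / 12))"
        using D by (subst ennreal_mult) (auto simp: ennreal_plus[symmetric] simp del: ennreal_plus)
      finally have "D \<le> 3 * (D / 12 + ?R + D / 12)"
        using D by (subst (asm) ennreal_le_iff) auto
      then show ?case by (simp add: D_def)
    qed
  qed
qed

section \<open>Small ball estimates and measurability\<close>

lemma nn_integral_lborel_uminus:
  fixes f :: "real \<Rightarrow> ennreal"
  assumes "f \<in> borel_measurable borel"
  shows "(\<integral>\<^sup>+x. f (- x) \<partial>lborel) = (\<integral>\<^sup>+x. f x \<partial>lborel)"
  using nn_integral_real_affine[OF assms, of "-1" 0] by simp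

text \<open>The clipping stands for the bound 1 on characteristic functions. It removes the
  singularity at 0, and \<open>e > 1\<close> takes care of infinity.\<close>

lemma nn_integral_min_1_powr_finite:
  assumes e: "1 < e" and A: "0 \<le> A"
  shows "(\<integral>\<^sup>+v. ennreal (min 1 (A * \<bar>v\<bar> powr (- e))) \<partial>lborel) < \<infinity>"
proof -
  let ?tail = "\<lambda>v::real. ennreal (v powr (- e)) * indicator {1..} v"
  have "(\<integral>\<^sup>+v. ennreal (min 1 (A * \<bar>v\<bar> powr (- e))) \<partial>lborel)
      \<le> (\<integral>\<^sup>+v. indicator {-1..1} v + ennreal A * (?tail v + ?tail (- v)) \<partial>lborel)"
  proof (intro nn_integral_mono)
    fix v :: real
    consider "v \<in> {-1..1}" | "1 < v" | "1 < - v" by fastforce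
    then show "ennreal (min 1 (A * \<bar>v\<bar> powr (- e))) \<le> indicator {-1..1} v + ennreal A * (?tail v + ?tail (- v))"
    proof cases
      case 1
      have "ennreal (min 1 (A * \<bar>v\<bar> powr (- e))) \<le> ennreal 1" by (intro ennreal_leI) auto
      then show ?thesis using 1 by (simp add: add_increasing2)
    qed (use A in \<open>auto simp: ennreal_mult[symmetric] intro!: ennreal_leI\<close>)
  qed
  also have "\<dots> = 2 + ennreal A * ((\<integral>\<^sup>+v. ?tail v \<partial>lborel) + (\<integral>\<^sup>+v. ?tail (- v) \<partial>lborel))"
    by (simp add: nn_integral_add nn_integral_cmult)
  also have "(\<integral>\<^sup>+v. ?tail (- v) \<partial>lborel) = (\<integral>\<^sup>+v. ?tail v \<partial>lborel)"
    by (rule nn_integral_lborel_uminus) measurable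
  also have "(\<integral>\<^sup>+v. ?tail v \<partial>lborel) = ennreal (- (1 powr (- e + 1)) / (- e + 1))"
    by (rule nn_integral_has_integral_lebesgue'[OF _ has_integral_powr_to_inf]) (use e in auto)
  also have "2 + ennreal A * (\<dots> + \<dots>) < \<infinity>"
    by (simp add: ennreal_mult_less_top)
  finally show ?thesis .
qed

lemma nn_integral_abs_powr_diff_le:
  assumes H: "H < 1" and s: "s \<in> {0..1}"
  shows "(\<integral>\<^sup>+t. ennreal (\<bar>t - s\<bar> powr (- H)) * indicator {0..1} t \<partial>lborel) \<le> ennreal (2 / (1 - H))"
proof -
  let ?g = "\<lambda>v::real. ennreal (v powr (- H)) * indicator {0..1} v"
  have "(\<integral>\<^sup>+t. ennreal (\<bar>t - s\<bar> powr (- H)) * indicator {0..1} t \<partial>lborel)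
      = (\<integral>\<^sup>+v. ennreal (\<bar>v\<bar> powr (- H)) * indicator {0..1} (s + v) \<partial>lborel)"
    by (subst nn_integral_real_affine[where c = 1 and t = s]) auto
  also have "\<dots> \<le> (\<integral>\<^sup>+v. ?g v + ?g (- v) \<partial>lborel)"
    using s by (intro nn_integral_mono) (auto simp: indicator_def)
  also have "\<dots> = (\<integral>\<^sup>+v. ?g v \<partial>lborel) + (\<integral>\<^sup>+v. ?g (- v) \<partial>lborel)"
    by (rule nn_integral_add) measurable
  also have "(\<integral>\<^sup>+v. ?g (- v) \<partial>lborel) = (\<integral>\<^sup>+v. ?g v \<partial>lborel)"
    by (rule nn_integral_lborel_uminus) measurable
  also have "(\<integral>\<^sup>+v. ?g v \<partial>lborel) = ennreal (1 powr (- H + 1) / (- H + 1))"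
    by (rule nn_integral_has_integral_lebesgue'[OF _ has_integral_powr_from_0]) (use H in auto)
  also have "\<dots> + \<dots> = ennreal (2 / (1 - H))"
    using H by (simp add: ennreal_plus[symmetric] add_divide_distrib[symmetric] del: ennreal_plus)
  finally show ?thesis .
qed

section \<open>Expected Gaussian kernels from characteristic functions\<close>

lemma normal_density_eq_Fourier:
  assumes "0 < \<sigma>"
  shows "complex_of_real (normal_density 0 \<sigma> y)
    = of_real (1 / (\<sigma> * sqrt (2 * pi))) * (LINT x|lborel. of_real (std_normal_density x) * iexp (x * (y / \<sigma>)))"
proof -
  have "complex_of_real (exp (- ((y / \<sigma>)\<^sup>2) / 2)) = (LINT x|std_normal_distribution. iexp (y / \<sigma> * x))"
    using fun_cong[OF char_std_normal_distribution, of "y / \<sigma>"] by (simp add: char_def)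
  also have "\<dots> = (LINT x|lborel. std_normal_density x *\<^sub>R iexp (y / \<sigma> * x))"
    by (rule integral_density) auto
  finally have "complex_of_real (exp (- ((y / \<sigma>)\<^sup>2) / 2))
      = (LINT x|lborel. of_real (std_normal_density x) * iexp (x * (y / \<sigma>)))"
    by (simp add: scaleR_conv_of_real mult.commute)
  moreover have "normal_density 0 \<sigma> y = 1 / (\<sigma> * sqrt (2 * pi)) * exp (- ((y / \<sigma>)\<^sup>2) / 2)"
    using assms by (simp add: normal_density_def real_sqrt_mult power_divide mult_ac)
  ultimately show ?thesis by simp
qed

text \<open>By Fourier inversion the expectation is an integral of the characteristic function at
  \<open>x / \<sigma>\<close> against a Gaussian weight, which is at most
  \<open>1 / sqrt (2 * pi)\<close>. Substituting \<open>v = d / \<sigma> * x\<close> cancels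
  \<sigma>: the bound is uniform in the scale, and only the factor \<open>1 / d\<close> remembers
  the size of \<open>Y\<close>.\<close>

lemma (in prob_space) nn_integral_normal_density_le:
  assumes [measurable]: "Y \<in> borel_measurable M" and \<sigma>: "0 < \<sigma>" and d: "0 < d" and A: "0 \<le> A"
    and decay: "\<And>\<xi>. \<xi> \<noteq> 0 \<Longrightarrow> cmod (LINT \<omega>|M. iexp (\<xi> * Y \<omega>)) \<le> A * (\<bar>\<xi>\<bar> * d) powr (- e)"
  shows "(\<integral>\<^sup>+\<omega>. ennreal (normal_density 0 \<sigma> (Y \<omega>)) \<partial>M)
    \<le> ennreal (1 / (2 * pi * d)) * (\<integral>\<^sup>+v. ennreal (min 1 (A * \<bar>v\<bar> powr (- e))) \<partial>lborel)"
proof -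
  interpret P: pair_sigma_finite M lborel ..
  let ?n = std_normal_density
  let ?h = "\<lambda>v. min 1 (A * \<bar>v\<bar> powr (- e))"
  define \<phi> where "\<phi> \<xi> = (LINT \<omega>|M. iexp (\<xi> * Y \<omega>))" for \<xi>
  have int_iexp: "integrable M (\<lambda>\<omega>. iexp (\<xi> * Y \<omega>))" for \<xi>
    by (rule integrable_const_bound[where B = 1]) auto
  have int: "integrable (M \<Otimes>\<^sub>M lborel) (\<lambda>(\<omega>, x). of_real (?n x) * iexp (x * (Y \<omega> / \<sigma>)))"
  proof (rule P.Fubini_integrable)
    show "integrable M (\<lambda>\<omega>. LINT x|lborel. norm (case (\<omega>, x) of (\<omega>, x) \<Rightarrow> complex_of_real (?n x) * iexp (x * (Y \<omega> / \<sigma>))))"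
      by (simp add: norm_mult)
    show "AE \<omega> in M. integrable lborel (\<lambda>x. case (\<omega>, x) of (\<omega>, x) \<Rightarrow> complex_of_real (?n x) * iexp (x * (Y \<omega> / \<sigma>)))"
    proof (intro AE_I2)
      fix \<omega>
      show "integrable lborel (\<lambda>x. case (\<omega>, x) of (\<omega>, x) \<Rightarrow> complex_of_real (?n x) * iexp (x * (Y \<omega> / \<sigma>)))"
        by (rule Bochner_Integration.integrable_bound[of _ ?n]) (auto simp: norm_mult)
    qed
  qed measurable
  have int_nd: "integrable M (\<lambda>\<omega>. normal_density 0 \<sigma> (Y \<omega>))"
  proof (rule integrable_const_bound[where B = "1 / sqrt (2 * pi * \<sigma>\<^sup>2)"])
    show "AE \<omega> in M. norm (normal_density 0 \<sigma> (Y \<omega>)) \<le> 1 / sqrt (2 * pi * \<sigma>\<^sup>2)"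
      by (intro AE_I2) (simp add: normal_density_def divide_right_mono)
  qed measurable
  define Z where "Z = (LINT \<omega>|M. LINT x|lborel. complex_of_real (?n x) * iexp (x * (Y \<omega> / \<sigma>)))"
  have "of_real (LINT \<omega>|M. normal_density 0 \<sigma> (Y \<omega>)) = of_real (1 / (\<sigma> * sqrt (2 * pi))) * Z"
    unfolding Z_def integral_complex_of_real[symmetric] normal_density_eq_Fourier[OF \<sigma>]
    by (rule integral_mult_right_zero)
  then have "\<bar>LINT \<omega>|M. normal_density 0 \<sigma> (Y \<omega>)\<bar> = 1 / (\<sigma> * sqrt (2 * pi)) * cmod Z"
    using \<sigma> by (metis abs_of_pos divide_pos_pos mult_pos_pos norm_mult norm_of_real pi_gt_zero real_sqrt_gt_zero zero_less_numeral zero_less_one)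
  then have "(\<integral>\<^sup>+\<omega>. ennreal (normal_density 0 \<sigma> (Y \<omega>)) \<partial>M) = ennreal (1 / (\<sigma> * sqrt (2 * pi))) * ennreal (cmod Z)"
    using int_nd \<sigma> by (simp add: nn_integral_eq_integral ennreal_mult[symmetric])
  also have "ennreal (cmod Z) \<le> ennreal (1 / sqrt (2 * pi)) * (ennreal (\<sigma> / d) * (\<integral>\<^sup>+v. ennreal (?h v) \<partial>lborel))"
  proof -
    have "Z = (LINT x|lborel. LINT \<omega>|M. complex_of_real (?n x) * iexp (x * (Y \<omega> / \<sigma>)))"
      unfolding Z_def using P.Fubini_integral[of "\<lambda>\<omega> x. complex_of_real (?n x) * iexp (x * (Y \<omega> / \<sigma>))"] int by simp
    also have "\<dots> = (LINT x|lborel. of_real (?n x) * \<phi> (x / \<sigma>))"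
      by (intro Bochner_Integration.integral_cong) (simp_all add: \<phi>_def)
    finally have Z: "Z = (LINT x|lborel. of_real (?n x) * \<phi> (x / \<sigma>))" .
    have int2: "integrable lborel (\<lambda>x. of_real (?n x) * \<phi> (x / \<sigma>))"
    proof -
      have "integrable lborel (\<lambda>x. LINT \<omega>|M. complex_of_real (?n x) * iexp (x * (Y \<omega> / \<sigma>)))"
        using P.integrable_snd[of "\<lambda>\<omega> x. complex_of_real (?n x) * iexp (x * (Y \<omega> / \<sigma>))"] int by simp
      also have "(\<lambda>x. LINT \<omega>|M. complex_of_real (?n x) * iexp (x * (Y \<omega> / \<sigma>))) = (\<lambda>x. of_real (?n x) * \<phi> (x / \<sigma>))"
        by (rule ext) (simp add: \<phi>_def)
      finally show ?thesis .
    qed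
    have "ennreal (cmod Z) \<le> (\<integral>\<^sup>+x. ennreal (cmod (of_real (?n x) * \<phi> (x / \<sigma>))) \<partial>lborel)"
      unfolding Z by (rule integral_norm_bound_ennreal[OF int2])
    also have "\<dots> \<le> (\<integral>\<^sup>+x. ennreal (1 / sqrt (2 * pi)) * ennreal (?h (d / \<sigma> * x)) \<partial>lborel)"
    proof (rule nn_integral_mono_AE)
      have "AE x in lborel. x \<noteq> (0::real)" by (rule AE_lborel_singleton)
      then show "AE x in lborel. ennreal (cmod (of_real (?n x) * \<phi> (x / \<sigma>))) \<le> ennreal (1 / sqrt (2 * pi)) * ennreal (?h (d / \<sigma> * x))"
      proof eventually_elim
        case (elim x)
        have "cmod (\<phi> (x / \<sigma>)) \<le> (LINT \<omega>|M. cmod (iexp (x / \<sigma> * Y \<omega>)))"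
          unfolding \<phi>_def by (rule integral_norm_bound)
        then have "cmod (\<phi> (x / \<sigma>)) \<le> 1" by (simp add: prob_space)
        moreover have "cmod (\<phi> (x / \<sigma>)) \<le> A * \<bar>d / \<sigma> * x\<bar> powr (- e)"
          using decay[of "x / \<sigma>"] elim \<sigma> d by (simp add: \<phi>_def abs_mult mult.commute)
        ultimately have "cmod (\<phi> (x / \<sigma>)) \<le> ?h (d / \<sigma> * x)" by simp
        moreover have "?n x \<le> 1 / sqrt (2 * pi)"
          by (simp add: normal_density_def divide_right_mono)
        ultimately have "cmod (of_real (?n x) * \<phi> (x / \<sigma>)) \<le> 1 / sqrt (2 * pi) * ?h (d / \<sigma> * x)"
          unfolding norm_mult by (intro mult_mono) auto
        then show ?case using A by (simp add: ennreal_mult[symmetric] ennreal_leI)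
      qed
    qed
    also have "\<dots> = ennreal (1 / sqrt (2 * pi)) * (\<integral>\<^sup>+x. ennreal (?h (d / \<sigma> * x)) \<partial>lborel)"
      by (rule nn_integral_cmult) measurable
    also have "(\<integral>\<^sup>+x. ennreal (?h (d / \<sigma> * x)) \<partial>lborel) = ennreal (\<sigma> / d) * (\<integral>\<^sup>+v. ennreal (?h v) \<partial>lborel)"
    proof -
      have "ennreal \<bar>\<sigma> / d\<bar> * (\<integral>\<^sup>+v. ennreal (?h (d / \<sigma> * (0 + \<sigma> / d * v))) \<partial>lborel) = (\<integral>\<^sup>+x. ennreal (?h (d / \<sigma> * x)) \<partial>lborel)"
        using \<sigma> d by (intro nn_integral_real_affine[symmetric]) auto
      then show ?thesis using \<sigma> d by simp
    qed
    finally show ?thesis .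
  qed
  also have "ennreal (1 / (\<sigma> * sqrt (2 * pi))) * (ennreal (1 / sqrt (2 * pi)) * (ennreal (\<sigma> / d) * (\<integral>\<^sup>+v. ennreal (?h v) \<partial>lborel)))
      = ennreal (1 / (\<sigma> * sqrt (2 * pi)) * (1 / sqrt (2 * pi) * (\<sigma> / d))) * (\<integral>\<^sup>+v. ennreal (?h v) \<partial>lborel)"
    using \<sigma> d by (simp only: mult.assoc[symmetric]) (simp add: ennreal_mult[symmetric])
  also have "1 / (\<sigma> * sqrt (2 * pi)) * (1 / sqrt (2 * pi) * (\<sigma> / d)) = 1 / (2 * pi * d)"
    using \<sigma> d by simp
  finally show ?thesis by (simp add: mult_left_mono)
qed

section \<open>Passage from test functions to L2 limits\<close>

lemma norm_iexp_diff_le: "cmod (iexp x - iexp y) \<le> \<bar>x - y\<bar>"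
proof -
  have "iexp x - iexp y = iexp y * (iexp (x - y) - 1)"
    by (simp add: right_diff_distrib exp_add[symmetric] algebra_simps)
  then have "cmod (iexp x - iexp y) = cmod (iexp (x - y) - 1)"
    by (simp add: norm_mult)
  then show ?thesis using iexp_approx1[of "x - y" 0] by simp
qed

lemma (in prob_space) nn_integral_abs_tendsto_0:
  assumes [measurable]: "\<And>n. W n \<in> borel_measurable M"
    and lim: "(\<lambda>n. \<integral>\<^sup>+\<omega>. ennreal ((W n \<omega>)\<^sup>2) \<partial>M) \<longlonglongrightarrow> 0"
  shows "(\<lambda>n. \<integral>\<^sup>+\<omega>. ennreal \<bar>W n \<omega>\<bar> \<partial>M) \<longlonglongrightarrow> 0"
proof (rule order_tendstoI)
  fix r :: ennreal assume "0 < r"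
  then obtain q where q: "0 < q" "ennreal q < r"
    by (metis dense ennreal_cases ennreal_zero_less_top less_ennreal.rep_eq linorder_not_less not_gr_zero ennreal_less_zero_iff top.not_eq_extremum top_greatest order.strict_trans)
  have "0 < ennreal (q\<^sup>2)" using q by simp
  from order_tendstoD(2)[OF lim this]
  show "\<forall>\<^sub>F n in sequentially. (\<integral>\<^sup>+\<omega>. ennreal \<bar>W n \<omega>\<bar> \<partial>M) < r"
  proof eventually_elim
    case (elim n)
    have "(\<integral>\<^sup>+\<omega>. ennreal \<bar>W n \<omega>\<bar> * 1 \<partial>M)\<^sup>2 \<le> (\<integral>\<^sup>+\<omega>. (ennreal \<bar>W n \<omega>\<bar>)\<^sup>2 \<partial>M) * (\<integral>\<^sup>+\<omega>. 1\<^sup>2 \<partial>M)"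
      by (rule Cauchy_Schwarz_nn_integral) measurable
    then have "(\<integral>\<^sup>+\<omega>. ennreal \<bar>W n \<omega>\<bar> \<partial>M)\<^sup>2 \<le> ennreal (q\<^sup>2)"
      using elim by (simp add: ennreal_power emeasure_space_1)
    then have "(\<integral>\<^sup>+\<omega>. ennreal \<bar>W n \<omega>\<bar> \<partial>M) \<le> ennreal q"
      by (cases "\<integral>\<^sup>+\<omega>. ennreal \<bar>W n \<omega>\<bar> \<partial>M") (use q in \<open>auto simp: ennreal_power top_unique intro!: ennreal_leI power2_le_imp_le\<close>)
    then show ?case using q(2) by (rule le_less_trans)
  qed
qed simp

text \<open>\<open>iexp\<close> is Lipschitz, and on a probability space L2 convergence implies L1
  convergence. This carries bounds known for Schwartz functions over to the process.\<close>

lemma (in prob_space) char_tendsto_of_L2: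
  assumes [measurable]: "\<And>n. U n \<in> borel_measurable M" "\<And>n. V n \<in> borel_measurable M"
      "U' \<in> borel_measurable M" "V' \<in> borel_measurable M"
    and U: "(\<lambda>n. \<integral>\<^sup>+\<omega>. ennreal ((U n \<omega> - U' \<omega>)\<^sup>2) \<partial>M) \<longlonglongrightarrow> 0"
    and V: "(\<lambda>n. \<integral>\<^sup>+\<omega>. ennreal ((V n \<omega> - V' \<omega>)\<^sup>2) \<partial>M) \<longlonglongrightarrow> 0"
  shows "(\<lambda>n. LINT \<omega>|M. iexp (\<xi> * (U n \<omega> - V n \<omega>))) \<longlonglongrightarrow> (LINT \<omega>|M. iexp (\<xi> * (U' \<omega> - V' \<omega>)))"
proof -
  have lim: "(\<lambda>n. ennreal \<bar>\<xi>\<bar> * ((\<integral>\<^sup>+\<omega>. ennreal \<bar>U n \<omega> - U' \<omega>\<bar> \<partial>M) + (\<integral>\<^sup>+\<omega>. ennreal \<bar>V n \<omega> - V' \<omega>\<bar> \<partial>M)))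
      \<longlonglongrightarrow> ennreal \<bar>\<xi>\<bar> * (0 + 0)"
    using U V by (intro ennreal_tendsto_cmult tendsto_add nn_integral_abs_tendsto_0) auto
  have int: "integrable M (\<lambda>\<omega>. iexp (\<xi> * f \<omega>))" if [measurable]: "f \<in> borel_measurable M" for f
    by (rule integrable_const_bound[where B = 1]) auto
  have le: "ennreal (norm ((LINT \<omega>|M. iexp (\<xi> * (U n \<omega> - V n \<omega>))) - (LINT \<omega>|M. iexp (\<xi> * (U' \<omega> - V' \<omega>)))))
      \<le> ennreal \<bar>\<xi>\<bar> * ((\<integral>\<^sup>+\<omega>. ennreal \<bar>U n \<omega> - U' \<omega>\<bar> \<partial>M) + (\<integral>\<^sup>+\<omega>. ennreal \<bar>V n \<omega> - V' \<omega>\<bar> \<partial>M))" for n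
  proof -
    have "(LINT \<omega>|M. iexp (\<xi> * (U n \<omega> - V n \<omega>))) - (LINT \<omega>|M. iexp (\<xi> * (U' \<omega> - V' \<omega>)))
        = (LINT \<omega>|M. iexp (\<xi> * (U n \<omega> - V n \<omega>)) - iexp (\<xi> * (U' \<omega> - V' \<omega>)))"
      by (intro Bochner_Integration.integral_diff[symmetric] int) auto
    also have "ennreal (norm \<dots>) \<le> (\<integral>\<^sup>+\<omega>. ennreal (norm (iexp (\<xi> * (U n \<omega> - V n \<omega>)) - iexp (\<xi> * (U' \<omega> - V' \<omega>)))) \<partial>M)"
      by (intro integral_norm_bound_ennreal Bochner_Integration.integrable_diff int) auto
    also have "\<dots> \<le> (\<integral>\<^sup>+\<omega>. ennreal \<bar>\<xi>\<bar> * (ennreal \<bar>U n \<omega> - U' \<omega>\<bar> + ennreal \<bar>V n \<omega> - V' \<omega>\<bar>) \<partial>M)"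
    proof (intro nn_integral_mono)
      fix \<omega>
      have "cmod (iexp (\<xi> * (U n \<omega> - V n \<omega>)) - iexp (\<xi> * (U' \<omega> - V' \<omega>))) \<le> \<bar>\<xi> * (U n \<omega> - V n \<omega>) - \<xi> * (U' \<omega> - V' \<omega>)\<bar>"
        by (rule norm_iexp_diff_le)
      also have "\<dots> = \<bar>\<xi>\<bar> * \<bar>(U n \<omega> - U' \<omega>) - (V n \<omega> - V' \<omega>)\<bar>"
        by (simp add: abs_mult[symmetric] algebra_simps)
      also have "\<dots> \<le> \<bar>\<xi>\<bar> * (\<bar>U n \<omega> - U' \<omega>\<bar> + \<bar>V n \<omega> - V' \<omega>\<bar>)"
        by (intro mult_left_mono abs_triangle_ineq4) auto
      finally show "ennreal (norm (iexp (\<xi> * (U n \<omega> - V n \<omega>)) - iexp (\<xi> * (U' \<omega> - V' \<omega>))))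
          \<le> ennreal \<bar>\<xi>\<bar> * (ennreal \<bar>U n \<omega> - U' \<omega>\<bar> + ennreal \<bar>V n \<omega> - V' \<omega>\<bar>)"
        by (simp add: ennreal_mult[symmetric] ennreal_plus[symmetric] ennreal_leI del: ennreal_plus)
    qed
    also have "\<dots> = ennreal \<bar>\<xi>\<bar> * ((\<integral>\<^sup>+\<omega>. ennreal \<bar>U n \<omega> - U' \<omega>\<bar> \<partial>M) + (\<integral>\<^sup>+\<omega>. ennreal \<bar>V n \<omega> - V' \<omega>\<bar> \<partial>M))"
      by (simp add: nn_integral_cmult nn_integral_add)
    finally show ?thesis .
  qed
  have "(\<lambda>n. ennreal (norm ((LINT \<omega>|M. iexp (\<xi> * (U n \<omega> - V n \<omega>))) - (LINT \<omega>|M. iexp (\<xi> * (U' \<omega> - V' \<omega>)))))) \<longlonglongrightarrow> 0"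
    by (rule tendsto_sandwich[OF _ _ tendsto_const]) (use le lim in auto)
  then have "(\<lambda>n. norm ((LINT \<omega>|M. iexp (\<xi> * (U n \<omega> - V n \<omega>))) - (LINT \<omega>|M. iexp (\<xi> * (U' \<omega> - V' \<omega>))))) \<longlonglongrightarrow> 0"
    by (simp add: ennreal_tendsto_0_iff)
  then show ?thesis by (simp add: tendsto_norm_zero_iff LIM_zero_iff)
qed

text \<open>Time is rounded down to the grid of mesh \<open>1 / Suc n\<close>. The rounded process
  involves countably many times, hence is jointly measurable, and converges by continuity;
  \<open>t \<ge> 0\<close> keeps the grid points inside the domain of continuity.\<close>

lemma borel_measurable_continuous_paths:
  fixes X :: "real \<Rightarrow> 'a \<Rightarrow> real"
  assumes meas: "\<And>t. 0 \<le> t \<Longrightarrow> X t \<in> borel_measurable M"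
    and cont: "\<And>\<omega>. \<omega> \<in> space M \<Longrightarrow> continuous_on {0..} (\<lambda>t. X t \<omega>)"
    and L: "space L \<subseteq> {0..}" "(\<lambda>t. t) \<in> borel_measurable L"
  shows "(\<lambda>(t, \<omega>). X t \<omega>) \<in> borel_measurable (L \<Otimes>\<^sub>M M)"
proof (rule borel_measurable_LIMSEQ_real)
  fix n :: nat
  have [measurable]: "(\<lambda>t. t) \<in> borel_measurable L" by (rule L)
  show "(\<lambda>p. X (real (nat \<lfloor>real (Suc n) * fst p\<rfloor>) / real (Suc n)) (snd p)) \<in> borel_measurable (L \<Otimes>\<^sub>M M)"
  proof (rule measurable_compose_countable[where f = "\<lambda>i p. X (real i / real (Suc n)) (snd p)"])
    show "(\<lambda>p. X (real i / real (Suc n)) (snd p)) \<in> borel_measurable (L \<Otimes>\<^sub>M M)" for i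
      by (rule measurable_compose[OF measurable_snd meas]) simp
  next
    have "fst \<in> borel_measurable (L \<Otimes>\<^sub>M M)"
      using measurable_compose[OF measurable_fst L(2)] by simp
    then show "(\<lambda>p. nat \<lfloor>real (Suc n) * fst p\<rfloor>) \<in> L \<Otimes>\<^sub>M M \<rightarrow>\<^sub>M count_space UNIV"
      by measurable
  qed
next
  fix p assume p: "p \<in> space (L \<Otimes>\<^sub>M M)"
  obtain t \<omega> where t: "p = (t, \<omega>)" "0 \<le> t" "\<omega> \<in> space M"
    using p L by (cases p) (auto simp: space_pair_measure)
  have "(\<lambda>n. real (nat \<lfloor>real (Suc n) * t\<rfloor>) / real (Suc n)) \<longlonglongrightarrow> t"
  proof (rule tendsto_sandwich)
    show "(\<lambda>n. t - 1 / real (Suc n)) \<longlonglongrightarrow> t" by real_asymp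
    show "(\<lambda>n. t) \<longlonglongrightarrow> t" by simp
    have fl: "real (nat \<lfloor>real (Suc n) * t\<rfloor>) = of_int \<lfloor>real (Suc n) * t\<rfloor>" for n
      using t by (simp del: of_nat_Suc)
    have "of_int \<lfloor>real (Suc n) * t\<rfloor> \<le> real (Suc n) * t" "real (Suc n) * t - 1 \<le> of_int \<lfloor>real (Suc n) * t\<rfloor>" for n
      by linarith+
    then show "\<forall>\<^sub>F n in sequentially. real (nat \<lfloor>real (Suc n) * t\<rfloor>) / real (Suc n) \<le> t"
      "\<forall>\<^sub>F n in sequentially. t - 1 / real (Suc n) \<le> real (nat \<lfloor>real (Suc n) * t\<rfloor>) / real (Suc n)"
      unfolding fl by (auto simp: divide_simps mult.commute simp del: of_nat_Suc intro!: always_eventually)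
  qed
  then have "(\<lambda>n. X (real (nat \<lfloor>real (Suc n) * t\<rfloor>) / real (Suc n)) \<omega>) \<longlonglongrightarrow> X t \<omega>"
    using cont[OF t(3)] t(2) by (intro continuous_on_tendsto_compose[where f = "\<lambda>t. X t \<omega>"]) auto
  then show "(\<lambda>n. X (real (nat \<lfloor>real (Suc n) * fst p\<rfloor>) / real (Suc n)) (snd p)) \<longlonglongrightarrow> (case p of (t, \<omega>) \<Rightarrow> X t \<omega>)"
    by (simp add: t)
qed

section \<open>The local time\<close>

lemma cylinder_algebra_measurable:
  assumes "sets M = sets cylinder_algebra" "\<phi> \<in> schwartz"
  shows "(\<lambda>\<omega>. \<omega> \<phi>) \<in> borel_measurable M" "space M = tempered"
proof -
  let ?G = "{{\<omega> \<in> tempered. \<omega> \<phi> \<in> C} | \<phi> C. \<phi> \<in> schwartz \<and> C \<in> sets (borel :: real measure)}"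
  have G: "?G \<subseteq> Pow tempered" by auto
  then have sets: "sets M = sigma_sets tempered ?G" and space: "space cylinder_algebra = tempered"
    using assms(1) by (simp_all add: cylinder_algebra_def space_measure_of_conv)
  show sp: "space M = tempered" using sets_eq_imp_space_eq[OF assms(1)] space by simp
  show "(\<lambda>\<omega>. \<omega> \<phi>) \<in> borel_measurable M"
  proof (rule measurableI)
    fix C :: "real set" assume "C \<in> sets borel"
    moreover have "(\<lambda>\<omega>. \<omega> \<phi>) -` C \<inter> space M = {\<omega> \<in> tempered. \<omega> \<phi> \<in> C}" unfolding sp by auto
    ultimately show "(\<lambda>\<omega>. \<omega> \<phi>) -` C \<inter> space M \<in> sets M"
      using assms(2) unfolding sets by auto
  qed simp
qed

lemma tempered_linear:
  assumes "\<omega> \<in> tempered" "\<phi> \<in> schwartz" "\<psi> \<in> schwartz"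
  shows "\<omega> (\<lambda>x. r * \<phi> x + q * \<psi> x) = r * \<omega> \<phi> + q * \<omega> \<psi>"
proof -
  have "(\<lambda>x. r * \<phi> x) \<in> schwartz" "(\<lambda>x. q * \<psi> x) \<in> schwartz"
    using schwartz_linear[OF assms(2,2), of r 0] schwartz_linear[OF assms(3,3), of q 0] by simp_all
  then show ?thesis using assms unfolding tempered_def by simp
qed

text \<open>The characteristic functional is prescribed on Schwartz functions only, so the estimate
  is proved for approximating test functions and then passed to the limit. For this the lower bound
  on the norm of the increment is stated for approximants and holds eventually.\<close>

lemma increment_char_le:
  assumes A: "\<forall>i\<in>{1..p}. \<alpha> i > 0"
    and B: "\<forall>j\<in>{1..m}. \<beta> j > 0"
    and a_star: "fox_a_star m p \<alpha> \<beta> \<ge> 0"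
    and c: "0 < c" "\<forall>j\<in>{1..m}. c < (b j + \<beta> j) / \<beta> j"
    and M: "fox_H_measure c m p a \<alpha> b \<beta> M"
    and H: "0 < H" "H < 1"
    and X: "fox_H_process M H X"
    and strip: "\<forall>j\<in>{1..m}. 2 * b j + \<beta> j > 0"
  obtains D e where "0 \<le> D" "1 < e"
    "\<And>s t \<xi>. 0 \<le> s \<Longrightarrow> s < t \<Longrightarrow> \<xi> \<noteq> 0 \<Longrightarrow>
      cmod (LINT \<omega>|M. iexp (\<xi> * (X t \<omega> - X s \<omega>))) \<le> D * (\<bar>\<xi>\<bar> * (t - s) powr H) powr (- e)"
proof -
  obtain C q where C: "0 \<le> C" "1/2 < q"
    "\<And>s. s > 0 \<Longrightarrow> cmod (wright_neg c m p a \<alpha> b \<beta> s) \<le> C * s powr (-q)"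
    using norm_wright_neg_le[OF A B a_star c strip] by metis
  obtain c0 where c0: "0 < c0"
    "\<And>s t \<phi> \<psi>. 0 \<le> s \<Longrightarrow> s < t \<Longrightarrow> \<forall>n. \<phi> n \<in> schwartz \<Longrightarrow> \<forall>n. \<psi> n \<in> schwartz \<Longrightarrow>
      (\<lambda>n. \<integral>\<^sup>+ x. ennreal ((\<phi> n x - M_minus H (indicator {0..<t}) x)\<^sup>2) \<partial>lborel) \<longlonglongrightarrow> 0 \<Longrightarrow>
      (\<lambda>n. \<integral>\<^sup>+ x. ennreal ((\<psi> n x - M_minus H (indicator {0..<s}) x)\<^sup>2) \<partial>lborel) \<longlonglongrightarrow> 0 \<Longrightarrow>
      \<forall>\<^sub>F n in sequentially. c0 * (t - s) powr (2 * H) \<le> (LINT x|lborel. (\<phi> n x - \<psi> n x)\<^sup>2)"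
    using M_minus_increment_lower_bound[OF H] by blast
  have sets_M: "sets M = sets cylinder_algebra" and "prob_space M"
    and char: "\<And>\<phi>. \<phi> \<in> schwartz \<Longrightarrow> (LINT \<omega>|M. iexp (\<omega> \<phi>)) =
        1 / of_real (fox_K m p a \<alpha> b \<beta>) * wright_neg c m p a \<alpha> b \<beta> (1 / 2 * (LINT x|lborel. \<phi> x * \<phi> x))"
    using M unfolding fox_H_measure_def by auto
  interpret prob_space M by fact
  define k where "k = cmod (1 / of_real (fox_K m p a \<alpha> b \<beta>))"
  show ?thesis
  \<comment> \<open>The exponent doubles because the argument of the Wright function is quadratic in
    \<xi>; \<open>c0 / 2\<close> combines the norm bound with the factor \<open>1 / 2\<close> of the
    functional.\<close>
  proof (rule that[of "k * C * (c0 / 2) powr (- q)" "2 * q"])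
    show "0 \<le> k * C * (c0 / 2) powr (- q)" using C by (simp add: k_def)
    show "1 < 2 * q" using C by simp
    fix s t \<xi> :: real assume st: "0 \<le> s" "s < t" and \<xi>: "\<xi> \<noteq> 0"
    have pt: "L2_pairing M (M_minus H (indicator {0..<t})) (X t)" and ps: "L2_pairing M (M_minus H (indicator {0..<s})) (X s)"
      using X st unfolding fox_H_process_def by auto
    obtain \<phi> where \<phi>: "\<forall>n. \<phi> n \<in> schwartz"
      "(\<lambda>n. \<integral>\<^sup>+ x. ennreal ((\<phi> n x - M_minus H (indicator {0..<t}) x)\<^sup>2) \<partial>lborel) \<longlonglongrightarrow> 0"
      "(\<lambda>n. \<integral>\<^sup>+ \<omega>. ennreal ((\<omega> (\<phi> n) - X t \<omega>)\<^sup>2) \<partial>M) \<longlonglongrightarrow> 0"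
      using pt unfolding L2_pairing_def by blast
    obtain \<psi> where \<psi>: "\<forall>n. \<psi> n \<in> schwartz"
      "(\<lambda>n. \<integral>\<^sup>+ x. ennreal ((\<psi> n x - M_minus H (indicator {0..<s}) x)\<^sup>2) \<partial>lborel) \<longlonglongrightarrow> 0"
      "(\<lambda>n. \<integral>\<^sup>+ \<omega>. ennreal ((\<omega> (\<psi> n) - X s \<omega>)\<^sup>2) \<partial>M) \<longlonglongrightarrow> 0"
      using ps unfolding L2_pairing_def by blast
    have "(\<lambda>n. LINT \<omega>|M. iexp (\<xi> * (\<omega> (\<phi> n) - \<omega> (\<psi> n)))) \<longlonglongrightarrow> (LINT \<omega>|M. iexp (\<xi> * (X t \<omega> - X s \<omega>)))"
      using \<phi> \<psi> pt ps sets_M unfolding L2_pairing_def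
      by (intro char_tendsto_of_L2 cylinder_algebra_measurable) auto
    then have lim: "(\<lambda>n. cmod (LINT \<omega>|M. iexp (\<xi> * (\<omega> (\<phi> n) - \<omega> (\<psi> n))))) \<longlonglongrightarrow> cmod (LINT \<omega>|M. iexp (\<xi> * (X t \<omega> - X s \<omega>)))"
      by (rule tendsto_norm)
    show "cmod (LINT \<omega>|M. iexp (\<xi> * (X t \<omega> - X s \<omega>))) \<le> k * C * (c0 / 2) powr (- q) * (\<bar>\<xi>\<bar> * (t - s) powr H) powr (- (2 * q))"
    proof (rule tendsto_upperbound[OF lim])
      show "\<forall>\<^sub>F n in sequentially. cmod (LINT \<omega>|M. iexp (\<xi> * (\<omega> (\<phi> n) - \<omega> (\<psi> n))))
          \<le> k * C * (c0 / 2) powr (- q) * (\<bar>\<xi>\<bar> * (t - s) powr H) powr (- (2 * q))"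
        using c0(2)[OF st \<phi>(1) \<psi>(1) \<phi>(2) \<psi>(2)]
      proof eventually_elim
        case (elim n)
        \<comment> \<open>By linearity of tempered distributions, the characteristic function of the
          difference at \<xi> is the functional at this single test function.\<close>
        define \<rho> where "\<rho> x = \<xi> * \<phi> n x + (- \<xi>) * \<psi> n x" for x
        have \<rho>: "\<rho> \<in> schwartz" unfolding \<rho>_def using \<phi> \<psi> by (intro schwartz_linear) auto
        define r where "r = 1 / 2 * (LINT x|lborel. \<rho> x * \<rho> x)"
        define r0 where "r0 = c0 / 2 * (\<bar>\<xi>\<bar> * (t - s) powr H)\<^sup>2"
        have "(LINT x|lborel. \<rho> x * \<rho> x) = \<xi>\<^sup>2 * (LINT x|lborel. (\<phi> n x - \<psi> n x)\<^sup>2)"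
          unfolding integral_mult_right_zero[symmetric]
          by (intro Bochner_Integration.integral_cong) (auto simp: \<rho>_def power2_eq_square algebra_simps)
        moreover have "(t - s) powr (2 * H) = ((t - s) powr H)\<^sup>2"
          using st by (simp add: power2_eq_square flip: powr_add)
        ultimately have r: "r0 \<le> r"
          using mult_left_mono[OF elim, of "\<xi>\<^sup>2"] by (simp add: r_def r0_def power_mult_distrib mult_ac)
        have r0: "0 < r0" using c0 \<xi> st by (simp add: r0_def)
        have "(LINT \<omega>|M. iexp (\<xi> * (\<omega> (\<phi> n) - \<omega> (\<psi> n)))) = (LINT \<omega>|M. iexp (\<omega> \<rho>))"
        proof (rule Bochner_Integration.integral_cong[OF refl])
          fix \<omega> assume "\<omega> \<in> space M"
          then have "\<omega> \<in> tempered" using cylinder_algebra_measurable(2)[OF sets_M \<rho>] by simp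
          then have "\<omega> \<rho> = \<xi> * (\<omega> (\<phi> n) - \<omega> (\<psi> n))"
            unfolding \<rho>_def using \<phi>(1) \<psi>(1) by (subst tempered_linear) (auto simp: algebra_simps)
          then show "iexp (\<xi> * (\<omega> (\<phi> n) - \<omega> (\<psi> n))) = iexp (\<omega> \<rho>)" by simp
        qed
        also have "cmod \<dots> = k * cmod (wright_neg c m p a \<alpha> b \<beta> r)"
          unfolding char[OF \<rho>] r_def k_def by (rule norm_mult)
        also have "\<dots> \<le> k * (C * r powr (- q))"
          using C(3)[of r] r r0 by (intro mult_left_mono) (auto simp: k_def)
        \<comment> \<open>A negative power reverses the inequality, so the lower bound on the norm
          becomes an upper bound here.\<close>
        also have "\<dots> \<le> k * (C * r0 powr (- q))"
          using C r r0 by (intro mult_left_mono powr_mono2') (auto simp: k_def)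
        also have "r0 powr (- q) = (c0 / 2) powr (- q) * (\<bar>\<xi>\<bar> * (t - s) powr H) powr (- (2 * q))"
        proof -
          let ?y = "\<bar>\<xi>\<bar> * (t - s) powr H"
          have y: "0 < ?y" using \<xi> st by simp
          have "(?y\<^sup>2) powr (- q) = ?y powr (- (2 * q))"
            using y by (simp add: powr_powr flip: powr_numeral)
          then show ?thesis
            unfolding r0_def using c0 y by (subst powr_mult) auto
        qed
        finally show ?case by (simp add: mult_ac)
      qed
    qed simp
  qed
qed

theorem theorem4p1:
  fixes m p :: nat
    and a \<alpha> b \<beta> :: "nat \<Rightarrow> real"
    and \<gamma> c H :: real
    and M :: "((real \<Rightarrow> real) \<Rightarrow> real) measure"
    and X :: "real \<Rightarrow> ((real \<Rightarrow> real) \<Rightarrow> real) \<Rightarrow> real"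
  assumes A: "\<forall>i\<in>{1..p}. \<alpha> i > 0 \<and> a i + \<alpha> i > 0"
    and B: "\<forall>j\<in>{1..m}. \<beta> j > 0 \<and> b j + \<beta> j > 0"
    and a_star: "fox_a_star m p \<alpha> \<beta> > 0 \<or> fox_a_star m p \<alpha> \<beta> = 0 \<and> fox_mu m p a b < -1"
    and \<gamma>: "\<forall>j\<in>{1..m}. \<gamma> > - b j / \<beta> j"
    and H_nonneg: "\<forall>\<tau>>0. fox_H \<gamma> m p a \<alpha> b \<beta> \<tau> \<in> \<real>\<^sub>\<ge>\<^sub>0"
    and c: "0 < c" "\<forall>j\<in>{1..m}. c < (b j + \<beta> j) / \<beta> j"
    and M: "fox_H_measure c m p a \<alpha> b \<beta> M"
    and H: "0 < H" "H < 1"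
    and X: "fox_H_process M H X"
    and strip: "\<forall>j\<in>{1..m}. 2 * b j + \<beta> j > 0"
  shows "\<forall>I\<in>sets borel. I \<subseteq> {0..1} \<longrightarrow>
    (AE \<omega> in M. has_occupation_density (\<lambda>t. X t \<omega>) I \<and>
       (\<integral>\<^sup>+ x. (occupation_density (\<lambda>t. X t \<omega>) I x)\<^sup>2 \<partial>lborel) < \<infinity>)"
proof (intro ballI impI)
  fix I :: "real set" assume I: "I \<in> sets borel" "I \<subseteq> {0..1}"
  obtain D e where D: "0 \<le> D" "1 < e"
    "\<And>s t \<xi>. 0 \<le> s \<Longrightarrow> s < t \<Longrightarrow> \<xi> \<noteq> 0 \<Longrightarrow>
      cmod (LINT \<omega>|M. iexp (\<xi> * (X t \<omega> - X s \<omega>))) \<le> D * (\<bar>\<xi>\<bar> * (t - s) powr H) powr (- e)"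
  proof (rule increment_char_le[OF _ _ _ c M H X strip])
    show "\<forall>i\<in>{1..p}. \<alpha> i > 0" "\<forall>j\<in>{1..m}. \<beta> j > 0" "fox_a_star m p \<alpha> \<beta> \<ge> 0"
      using A B a_star by auto
  qed blast
  interpret prob_space M using M unfolding fox_H_measure_def by simp
  define \<Lambda> where "\<Lambda> = restrict_space lborel I"
  have space_\<Lambda>: "space \<Lambda> = I" by (simp add: \<Lambda>_def space_restrict_space)
  have sets_\<Lambda>: "sets \<Lambda> = sets (restrict_space borel I)"
    unfolding \<Lambda>_def by (intro sets_restrict_space_cong) simp
  have emeasure_\<Lambda>: "emeasure \<Lambda> (space \<Lambda>) \<le> 1"
  proof -
    have "emeasure \<Lambda> (space \<Lambda>) = emeasure lborel I"
      unfolding space_\<Lambda> unfolding \<Lambda>_def using I by (subst emeasure_restrict_space) auto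
    also have "\<dots> \<le> emeasure lborel {0..1::real}" using I by (intro emeasure_mono) auto
    finally show ?thesis by simp
  qed
  interpret \<Lambda>: finite_measure \<Lambda>
    by (rule finite_measureI) (use emeasure_\<Lambda> in \<open>auto simp: top_unique\<close>)
  interpret \<Lambda>\<Lambda>: pair_sigma_finite \<Lambda> \<Lambda> ..
  interpret M\<Lambda>: pair_sigma_finite M \<Lambda> ..
  have id_\<Lambda>: "(\<lambda>t. t) \<in> borel_measurable \<Lambda>"
    unfolding \<Lambda>_def by (rule measurable_restrict_space1) simp
  have X_meas: "X t \<in> borel_measurable M" if "0 \<le> t" for t
    using X that unfolding fox_H_process_def L2_pairing_def by blast
  have X_cont: "continuous_on {0..} (\<lambda>t. X t \<omega>)" if "\<omega> \<in> space M" for \<omega>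
    using X that unfolding fox_H_process_def by blast
  have X_pair: "(\<lambda>(t, \<omega>). X t \<omega>) \<in> borel_measurable (\<Lambda> \<Otimes>\<^sub>M M)"
    by (rule borel_measurable_continuous_paths[OF X_meas X_cont _ id_\<Lambda>]) (use I space_\<Lambda> in auto)
  \<comment> \<open>Stated for arbitrary measurable \<open>f\<close> and \<open>g\<close>, so that
    the measurability prover can treat \<open>X\<close> inside iterated integrals over several
    product spaces.\<close>
  have X_joint [measurable (raw)]: "(\<lambda>x. X (f x) (g x)) \<in> borel_measurable N"
    if "f \<in> N \<rightarrow>\<^sub>M \<Lambda>" "g \<in> N \<rightarrow>\<^sub>M M" for f g and N :: "'z measure"
    using measurable_compose[OF measurable_Pair[OF that] X_pair] by simp
  define \<sigma> where "\<sigma> n = 1 / real (Suc n)" for n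
  have \<sigma>: "0 < \<sigma> n" "\<sigma> \<longlonglongrightarrow> 0" for n
    unfolding \<sigma>_def by (simp, real_asymp)
  let ?k = "\<lambda>n x. ennreal (normal_density 0 (sqrt 2 * \<sigma> n) x)"
  define G where "G = (\<integral>\<^sup>+v. ennreal (min 1 (D * \<bar>v\<bar> powr (- e))) \<partial>lborel)"
  have G: "G < \<infinity>" unfolding G_def by (rule nn_integral_min_1_powr_finite[OF D(2,1)])
  have pair_lt: "(\<integral>\<^sup>+\<omega>. ?k n (X t \<omega> - X s \<omega>) \<partial>M) \<le> ennreal (1 / (2 * pi)) * G * ennreal (\<bar>t - s\<bar> powr (- H))"
    if "0 \<le> s" "s < t" for s t n
  proof -
    have "(\<integral>\<^sup>+\<omega>. ?k n (X t \<omega> - X s \<omega>) \<partial>M) \<le> ennreal (1 / (2 * pi * (t - s) powr H)) * G"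
      unfolding G_def
      using that \<sigma>(1)[of n] D(1) X_meas[of s] X_meas[of t] D(3)[OF that]
      by (intro nn_integral_normal_density_le) auto
    also have "1 / (2 * pi * (t - s) powr H) = 1 / (2 * pi) * \<bar>t - s\<bar> powr (- H)"
      using that by (simp add: powr_minus_divide)
    also have "ennreal \<dots> = ennreal (1 / (2 * pi)) * ennreal (\<bar>t - s\<bar> powr (- H))"
      by (rule ennreal_mult) auto
    finally show ?thesis by (simp only: mult_ac)
  qed
  \<comment> \<open>The Gaussian kernel is even, so the order of the two times is
    immaterial.\<close>
  have pair_ne: "(\<integral>\<^sup>+\<omega>. ?k n (X s \<omega> - X t \<omega>) \<partial>M) \<le> ennreal (1 / (2 * pi)) * G * ennreal (\<bar>t - s\<bar> powr (- H))"
    if "0 \<le> s" "0 \<le> t" "s \<noteq> t" for s t n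
  proof (cases "s < t")
    case True
    have "?k n (X s \<omega> - X t \<omega>) = ?k n (X t \<omega> - X s \<omega>)" for \<omega>
      by (simp add: normal_density_def power2_commute)
    then show ?thesis using pair_lt[OF that(1) True, of n] by simp
  next
    case False
    then show ?thesis using pair_lt[OF that(2), of s n] that by (simp add: abs_minus_commute)
  qed
  \<comment> \<open>The energy of the occupation measure, pulled back to pairs of times; in this
    form its measurability in the sample point follows from joint measurability of
    \<open>X\<close>.\<close>
  define Q where "Q n \<omega> = (\<integral>\<^sup>+s. \<integral>\<^sup>+t. ?k n (X s \<omega> - X t \<omega>) \<partial>\<Lambda> \<partial>\<Lambda>)" for n \<omega>
  have [measurable]: "Q n \<in> borel_measurable M" for n unfolding Q_def by measurable
  define E where "E = ennreal (1 / (2 * pi)) * G * ennreal (2 / (1 - H))"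
  have E: "E < \<infinity>" using G by (simp add: E_def ennreal_mult_less_top)
  have Q_le: "(\<integral>\<^sup>+\<omega>. Q n \<omega> \<partial>M) \<le> E" for n
  proof -
    have "(\<integral>\<^sup>+\<omega>. Q n \<omega> \<partial>M) = (\<integral>\<^sup>+s. \<integral>\<^sup>+\<omega>. \<integral>\<^sup>+t. ?k n (X s \<omega> - X t \<omega>) \<partial>\<Lambda> \<partial>M \<partial>\<Lambda>)"
      unfolding Q_def by (rule M\<Lambda>.Fubini'[symmetric]) measurable
    also have "\<dots> = (\<integral>\<^sup>+s. \<integral>\<^sup>+t. \<integral>\<^sup>+\<omega>. ?k n (X s \<omega> - X t \<omega>) \<partial>M \<partial>\<Lambda> \<partial>\<Lambda>)"
    proof (intro nn_integral_cong M\<Lambda>.Fubini'[symmetric])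
      fix s assume [measurable]: "s \<in> space \<Lambda>"
      show "(\<lambda>(\<omega>, t). ?k n (X s \<omega> - X t \<omega>)) \<in> borel_measurable (M \<Otimes>\<^sub>M \<Lambda>)" by measurable
    qed
    also have "\<dots> \<le> (\<integral>\<^sup>+s. E \<partial>\<Lambda>)"
    proof (rule nn_integral_mono)
      fix s assume s: "s \<in> space \<Lambda>"
      then have s01: "s \<in> {0..1}" using I space_\<Lambda> by auto
      \<comment> \<open>The diagonal has to be left out: there the kernel is positive while the
        bound is 0, because \<open>0 powr (- H) = 0\<close>.\<close>
      have "AE t in \<Lambda>. t \<noteq> s"
        unfolding \<Lambda>_def using I AE_lborel_singleton[of s] by (subst AE_restrict_space_iff) auto
      then have "AE t in \<Lambda>. (\<integral>\<^sup>+\<omega>. ?k n (X s \<omega> - X t \<omega>) \<partial>M) \<le> ennreal (1 / (2 * pi)) * G * ennreal (\<bar>t - s\<bar> powr (- H))"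
        using AE_space
      proof eventually_elim
        case (elim t)
        then show ?case using s01 I space_\<Lambda> by (intro pair_ne) auto
      qed
      then have "(\<integral>\<^sup>+t. \<integral>\<^sup>+\<omega>. ?k n (X s \<omega> - X t \<omega>) \<partial>M \<partial>\<Lambda>)
          \<le> (\<integral>\<^sup>+t. ennreal (1 / (2 * pi)) * G * ennreal (\<bar>t - s\<bar> powr (- H)) \<partial>\<Lambda>)"
        by (rule nn_integral_mono_AE)
      also have "\<dots> = ennreal (1 / (2 * pi)) * G * (\<integral>\<^sup>+t. ennreal (\<bar>t - s\<bar> powr (- H)) \<partial>\<Lambda>)"
        using id_\<Lambda> by (intro nn_integral_cmult) measurable
      also have "(\<integral>\<^sup>+t. ennreal (\<bar>t - s\<bar> powr (- H)) \<partial>\<Lambda>) \<le> ennreal (2 / (1 - H))"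
      proof -
        have "(\<integral>\<^sup>+t. ennreal (\<bar>t - s\<bar> powr (- H)) \<partial>\<Lambda>) = (\<integral>\<^sup>+t. ennreal (\<bar>t - s\<bar> powr (- H)) * indicator I t \<partial>lborel)"
          unfolding \<Lambda>_def using I by (intro nn_integral_restrict_space) auto
        also have "\<dots> \<le> (\<integral>\<^sup>+t. ennreal (\<bar>t - s\<bar> powr (- H)) * indicator {0..1} t \<partial>lborel)"
          using I by (intro nn_integral_mono mult_left_mono) (auto simp: indicator_def)
        also have "\<dots> \<le> ennreal (2 / (1 - H))" by (rule nn_integral_abs_powr_diff_le[OF H(2) s01])
        finally show ?thesis .
      qed
      finally show "(\<integral>\<^sup>+t. \<integral>\<^sup>+\<omega>. ?k n (X s \<omega> - X t \<omega>) \<partial>M \<partial>\<Lambda>) \<le> E"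
        unfolding E_def by (simp add: mult_left_mono)
    qed
    also have "\<dots> = E * emeasure \<Lambda> (space \<Lambda>)" by simp
    also have "\<dots> \<le> E * 1" by (intro mult_left_mono emeasure_\<Lambda>) simp
    finally show ?thesis by simp
  qed
  have "(\<integral>\<^sup>+\<omega>. liminf (\<lambda>n. Q n \<omega>) \<partial>M) \<le> liminf (\<lambda>n. \<integral>\<^sup>+\<omega>. Q n \<omega> \<partial>M)"
    by (rule nn_integral_liminf) measurable
  also have "\<dots> \<le> E" by (rule liminf_le_const[OF Q_le])
  finally have "AE \<omega> in M. liminf (\<lambda>n. Q n \<omega>) \<noteq> \<infinity>"
    using E by (intro nn_integral_PInf_AE) auto
  then show "AE \<omega> in M. has_occupation_density (\<lambda>t. X t \<omega>) I \<and>
       (\<integral>\<^sup>+ x. (occupation_density (\<lambda>t. X t \<omega>) I x)\<^sup>2 \<partial>lborel) < \<infinity>"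
    using AE_space
  proof eventually_elim
    case (elim \<omega>)
    then obtain L where L: "0 \<le> L" "liminf (\<lambda>n. Q n \<omega>) = ennreal L"
      by (cases "liminf (\<lambda>n. Q n \<omega>)") auto
    \<comment> \<open>Strictly above the lower limit, so that infinitely many energies lie below
      \<open>B\<close>. Both \<open>B\<close> and the resulting subsequence depend on the
      path.\<close>
    define B where "B = L + 1"
    have "infinite {n. Q n \<omega> \<le> ennreal B}"
    proof
      assume "finite {n. Q n \<omega> \<le> ennreal B}"
      then have "\<forall>\<^sub>F n in sequentially. \<not> Q n \<omega> \<le> ennreal B"
        by (simp add: eventually_cofinite flip: cofinite_eq_sequentially)
      then have "ennreal B \<le> liminf (\<lambda>n. Q n \<omega>)"
        by (intro Liminf_bounded) (auto elim: eventually_mono)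
      then show False using L by (simp add: B_def)
    qed
    then obtain r :: "nat \<Rightarrow> nat" where r: "strict_mono r" "\<And>n. Q (r n) \<omega> \<le> ennreal B"
      using infinite_enumerate by blast
    have [measurable]: "(\<lambda>t. X t \<omega>) \<in> borel_measurable \<Lambda>"
      using elim by measurable
    let ?\<mu> = "occupation_measure (\<lambda>t. X t \<omega>) I"
    have \<mu>: "?\<mu> = distr \<Lambda> borel (\<lambda>t. X t \<omega>)" by (simp add: occupation_measure_def \<Lambda>_def)
    interpret gaussian_energy ?\<mu> "\<sigma> \<circ> r" B
    proof (rule gaussian_energy.intro)
      show "finite_measure ?\<mu>" unfolding \<mu> by (rule \<Lambda>.finite_measure_distr) measurable
      show "(\<sigma> \<circ> r) \<longlonglongrightarrow> 0" by (rule LIMSEQ_subseq_LIMSEQ[OF \<sigma>(2) r(1)])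
      fix n
      have "(\<integral>\<^sup>+x. \<integral>\<^sup>+y. ?k (r n) (x - y) \<partial>?\<mu> \<partial>?\<mu>) = Q (r n) \<omega>"
        unfolding \<mu> Q_def by (simp add: nn_integral_distr)
      then show "(\<integral>\<^sup>+x. \<integral>\<^sup>+y. ennreal (normal_density 0 (sqrt 2 * (\<sigma> \<circ> r) n) (x - y)) \<partial>?\<mu> \<partial>?\<mu>) \<le> ennreal B"
        using r(2) by simp
    qed (use \<sigma> L in \<open>auto simp: \<mu> B_def\<close>)
    show ?case
      unfolding has_occupation_density_def occupation_density_def
      using absolutely_continuous_lborel RN_deriv_L2 by (auto intro: le_less_trans)
  qed
qed

end
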